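(* Let $u^\varepsilon$ be the Perron (minimal) solution of the problem $(E_\varepsilon)$: $\Delta_\infty u^\varepsilon=\zeta_\varepsilon(x,u^\varepsilon)$ in $\Omega$, $u^\varepsilon=\varphi^\varepsilon$ on $\partial\Omega$. For a sub-domain $\Omega'\Subset\Omega$ there exists $C>0$, depending on universal parameters and $\Omega'$, such that for $x_0\in\{u^\varepsilon>\varepsilon\}\cap\Omega'$ with $\varepsilon\le d_\varepsilon(x_0)$ there holds $$C^{-1}d_\varepsilon(x_0)\le u^\varepsilon(x_0)\le C\,d_\varepsilon(x_0).$$
   Context: $\Delta_\infty u=(Du)^TD^2u\,Du=\sum_{i,j=1}^n u_{x_i}u_{x_j}u_{x_ix_j}$; $\mathbb{R}_+=[0,\infty)$. A function $u\in C(\Omega)$ is a viscosity sub-solution (super-solution) of $\Delta_\infty u=f(x,u)$ in $\Omega$ if whenever $\phi\in C^2(\Omega)$ and $u-\phi$ has a local maximum (minimum) at $x_0\in\Omega$ with $\phi(x_0)=u(x_0)$, then $\Delta_\infty\phi(x_0)\ge f(x_0,\phi(x_0))$ (resp. $\le$); a viscosity solution is both. Setting: $\Omega\subset\mathbb{R}^n$ is a bounded domain with smooth boundary; $\varepsilon>0$; $0\le\varphi^\varepsilon\in C(\overline\Omega)$ with $\|\varphi^\varepsilon\|_{L^\infty(\Omega)}\le\mathcal A$, $\mathcal A>0$ a constant; $\zeta_\varepsilon:\Omega\times\mathbb{R}_+\to\mathbb{R}_+$ is smooth and satisfies $0\le\zeta_\varepsilon(x,t)\le\frac{\mathcal B}{\varepsilon}\chi_{(0,\varepsilon)}(t)+\mathcal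 C$ for all $(x,t)$, with constants $\mathcal B,\mathcal C\ge0$ independent of $\varepsilon$, and $\mathfrak R:=\inf_{\Omega\times[a,b]}\varepsilon\zeta_\varepsilon(x,\varepsilon t)>0$ for some $0\le a<b$, with $\mathfrak R$ not depending on $\varepsilon$. Perron solution: let $\underline u^\varepsilon$ and $\overline u^\varepsilon$ be the viscosity solutions of $\Delta_\infty\underline u^\varepsilon=\sup_{\Omega\times[0,\infty)}\zeta_\varepsilon$ and $\Delta_\infty\overline u^\varepsilon=0$ in $\Omega$, both equal to $\varphi^\varepsilon$ on $\partial\Omega$. Then $u^\varepsilon(x)=\inf w(x)$ over all viscosity super-solutions $w\in C(\overline\Omega)$ of $\Delta_\infty w=\zeta_\varepsilon(x,w)$ in $\Omega$ with $\underline u^\varepsilon\le w\le\overline u^\varepsilon$ and $w=\varphi^\varepsilon$ on $\partial\Omega$; it is a viscosity solution of $(E_\varepsilon)$. Notation: $\Omega_\varepsilon=\{x\in\Omega: 0\le u^\varepsilon\le\varepsilon\}$, $d_\varepsilon(x_0)=\operatorname{dist}(x_0,\Omega_\varepsilon)$. $\Omega'\Subset\Omega$ means $\overline{\Omega'}$ is compact and contained in $\Omega$. Universal parameters are the dimension and the structural constants of the problem ($n,\mathcal A,\mathcal B,\mathcal C$ and $a,b,\mathfrak R$); in particular not $\varepsilon$. *)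

theory Defs
  imports "HOL-Analysis.Analysis"
begin

definition partial_deriv :: "'a \<Rightarrow> ('a::euclidean_space \<Rightarrow> real) \<Rightarrow> 'a \<Rightarrow> real"
  where "partial_deriv i f x = frechet_derivative f (at x) i"

text \<open>The class \<open>C\<^sup>k(S)\<close>; the definition is meaningful for open \<open>S\<close> only.\<close>

fun Ck_on :: "nat \<Rightarrow> 'a::euclidean_space set \<Rightarrow> ('a \<Rightarrow> real) \<Rightarrow> bool" where
  "Ck_on 0 S f \<longleftrightarrow> continuous_on S f"
| "Ck_on (Suc k) S f \<longleftrightarrow>
     (\<forall>x\<in>S. f differentiable (at x)) \<and> (\<forall>i\<in>Basis. Ck_on k S (partial_deriv i f))"

text \<open>Smoothness on a set that need not be open (such as \<open>\<Omega> \<times> [0,\<infinity>)\<close>) means having a smooth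
  extension to an open neighbourhood.\<close>

definition smooth_on :: "'a::euclidean_space set \<Rightarrow> ('a \<Rightarrow> real) \<Rightarrow> bool" where
  "smooth_on S f \<longleftrightarrow>
     (\<exists>U g. open U \<and> S \<subseteq> U \<and> (\<forall>k. Ck_on k U g) \<and> (\<forall>x\<in>S. g x = f x))"

text \<open>The boundary is smooth if, near each of its points, the set is the negativity set of
  a smooth function whose derivative does not vanish at that point.\<close>

definition smooth_boundary :: "'a::euclidean_space set \<Rightarrow> bool" where
  "smooth_boundary \<Omega> \<longleftrightarrow>
     (\<forall>p\<in>frontier \<Omega>. \<exists>U \<rho>. open U \<and> p \<in> U \<and> smooth_on U \<rho> \<and>
        (\<exists>i\<in>Basis. partial_deriv i \<rho> p \<noteq> 0) \<and> \<Omega> \<inter> U = {x \<in> U. \<rho> x < 0})"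

definition smooth_bounded_domain :: "'a::euclidean_space set \<Rightarrow> bool" where
  "smooth_bounded_domain \<Omega> \<longleftrightarrow>
     open \<Omega> \<and> connected \<Omega> \<and> \<Omega> \<noteq> {} \<and> bounded \<Omega> \<and> smooth_boundary \<Omega>"

definition inf_laplacian :: "('a::euclidean_space \<Rightarrow> real) \<Rightarrow> 'a \<Rightarrow> real" where
  "inf_laplacian u x =
     (\<Sum>i\<in>Basis. \<Sum>j\<in>Basis. partial_deriv i u x * partial_deriv j u x *
        partial_deriv j (partial_deriv i u) x)"

definition viscosity_subsolution ::
  "'a::euclidean_space set \<Rightarrow> ('a \<Rightarrow> real \<Rightarrow> real) \<Rightarrow> ('a \<Rightarrow> real) \<Rightarrow> bool" where
  "viscosity_subsolution \<Omega> f u \<longleftrightarrow> continuous_on \<Omega> u \<and>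
     (\<forall>\<phi> x\<^sub>0. Ck_on 2 \<Omega> \<phi> \<and> x\<^sub>0 \<in> \<Omega> \<and>
        (\<forall>\<^sub>F x in nhds x\<^sub>0. u x - \<phi> x \<le> u x\<^sub>0 - \<phi> x\<^sub>0) \<and> \<phi> x\<^sub>0 = u x\<^sub>0 \<longrightarrow>
        inf_laplacian \<phi> x\<^sub>0 \<ge> f x\<^sub>0 (\<phi> x\<^sub>0))"

definition viscosity_supersolution ::
  "'a::euclidean_space set \<Rightarrow> ('a \<Rightarrow> real \<Rightarrow> real) \<Rightarrow> ('a \<Rightarrow> real) \<Rightarrow> bool" where
  "viscosity_supersolution \<Omega> f u \<longleftrightarrow> continuous_on \<Omega> u \<and>
     (\<forall>\<phi> x\<^sub>0. Ck_on 2 \<Omega> \<phi> \<and> x\<^sub>0 \<in> \<Omega> \<and>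
        (\<forall>\<^sub>F x in nhds x\<^sub>0. u x - \<phi> x \<ge> u x\<^sub>0 - \<phi> x\<^sub>0) \<and> \<phi> x\<^sub>0 = u x\<^sub>0 \<longrightarrow>
        inf_laplacian \<phi> x\<^sub>0 \<le> f x\<^sub>0 (\<phi> x\<^sub>0))"

definition viscosity_solution ::
  "'a::euclidean_space set \<Rightarrow> ('a \<Rightarrow> real \<Rightarrow> real) \<Rightarrow> ('a \<Rightarrow> real) \<Rightarrow> bool" where
  "viscosity_solution \<Omega> f u \<longleftrightarrow> viscosity_subsolution \<Omega> f u \<and> viscosity_supersolution \<Omega> f u"

definition has_boundary_values ::
  "'a::euclidean_space set \<Rightarrow> ('a \<Rightarrow> real) \<Rightarrow> ('a \<Rightarrow> real) \<Rightarrow> bool" where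
  "has_boundary_values \<Omega> \<phi> u \<longleftrightarrow>
     continuous_on (closure \<Omega>) u \<and> (\<forall>x\<in>frontier \<Omega>. u x = \<phi> x)"

text \<open>The reaction terms \<open>\<zeta>\<close> live on \<open>\<Omega> \<times> [0,\<infinity>)\<close>; as functions in HOL are total, the values
  \<open>\<zeta> x t\<close> with \<open>t < 0\<close> carry no meaning and nothing below may depend on them.\<close>

definition admissible_reaction ::
  "'a::euclidean_space set \<Rightarrow> real \<Rightarrow> real \<Rightarrow> real \<Rightarrow> real \<Rightarrow> real \<Rightarrow> real \<Rightarrow>
     ('a \<Rightarrow> real \<Rightarrow> real) \<Rightarrow> bool" where
  "admissible_reaction \<Omega> B C a b R \<epsilon> \<zeta> \<longleftrightarrow>
     smooth_on (\<Omega> \<times> {0..}) (\<lambda>(x, t). \<zeta> x t) \<and>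
     (\<forall>x\<in>\<Omega>. \<forall>t\<ge>0. 0 \<le> \<zeta> x t \<and> \<zeta> x t \<le> B / \<epsilon> * indicat_real {0<..<\<epsilon>} t + C) \<and>
     (INF (x, t)\<in>\<Omega> \<times> {a..b}. \<epsilon> * \<zeta> x (\<epsilon> * t)) = R"

text \<open>The supersolutions over which the Perron solution is the infimum. The condition
  \<open>0 \<le> w\<close> is what makes \<open>\<zeta>(x, w)\<close> defined.\<close>

definition perron_class ::
  "'a::euclidean_space set \<Rightarrow> ('a \<Rightarrow> real \<Rightarrow> real) \<Rightarrow> ('a \<Rightarrow> real) \<Rightarrow>
     ('a \<Rightarrow> real) \<Rightarrow> ('a \<Rightarrow> real) \<Rightarrow> ('a \<Rightarrow> real) set" where
  "perron_class \<Omega> \<zeta> \<phi> u_lo u_hi =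
     {w. has_boundary_values \<Omega> \<phi> w \<and> viscosity_supersolution \<Omega> \<zeta> w \<and>
         (\<forall>x\<in>\<Omega>. 0 \<le> w x \<and> u_lo x \<le> w x \<and> w x \<le> u_hi x)}"

definition perron_solution ::
  "'a::euclidean_space set \<Rightarrow> ('a \<Rightarrow> real \<Rightarrow> real) \<Rightarrow> ('a \<Rightarrow> real) \<Rightarrow> ('a \<Rightarrow> real) \<Rightarrow> bool" where
  "perron_solution \<Omega> \<zeta> \<phi> u \<longleftrightarrow>
     (\<exists>u_lo u_hi.
        viscosity_solution \<Omega> (\<lambda>_ _. SUP (y, t)\<in>\<Omega> \<times> {0..}. \<zeta> y t) u_lo \<and>
        has_boundary_values \<Omega> \<phi> u_lo \<and>
        viscosity_solution \<Omega> (\<lambda>_ _. 0) u_hi \<and>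
        has_boundary_values \<Omega> \<phi> u_hi \<and>
        (\<forall>x\<in>closure \<Omega>. u x = (INF w\<in>perron_class \<Omega> \<zeta> \<phi> u_lo u_hi. w x)))"

end

theory Submission
  imports Defs
begin

text \<open>
  The solution \<open>u\<close> is an infimum of nonnegative supersolutions \<open>w\<close>. Both bounds rest on one estimate for
  such a \<open>w\<close> (\<open>supersolution_growth_from_centre\<close>): if \<open>\<Delta>\<^sub>\<infinity> w \<le> M\<close> in a ball of radius \<open>r\<close> and \<open>w(c)\<^sup>3\<close>
  is large compared with \<open>M r\<^sup>4\<close>, then \<open>w\<close> is at least \<open>w(c) (1 - (|x - c|/r)\<^sup>1\<^sup>/\<^sup>2)\<close>. For the
  infinity Laplacian a single value at the centre suffices for this, since it has barriers that are
  singular only at one point, where they agree with \<open>w\<close>; the estimate contains both a Harnack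
  inequality and a Hopf lemma.

  Upper bound. In the ball of radius \<open>d\<close> about \<open>x\<^sub>0\<close> the solution exceeds \<open>\<epsilon>\<close>, so the reaction is at most
  \<open>C\<close> there. If \<open>u(x\<^sub>0)/d\<close> were huge, then the growth estimate would produce a point at
  distance about \<open>\<epsilon>\<close> from \<open>{u \<le> \<epsilon>}\<close> with a value that is a huge multiple of \<open>\<epsilon>\<close>. On the scale \<open>\<epsilon>\<close> the
  reaction \<open>B/\<epsilon> + C\<close> is of order one after rescaling, so a second application
  contradicts \<open>u \<le> \<epsilon>\<close> on that set (\<open>supersolution_le_distance\<close>).

  Lower bound. By minimality \<open>u\<close> cannot lie below a supersolution that dips to \<open>a \<epsilon> < \<epsilon>\<close> at \<open>x\<^sub>0\<close> on a whole
  sphere about \<open>x\<^sub>0\<close>, as otherwise the cut-off of a member of the Perron class would be a smaller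
  member. Such a supersolution with linear growth exists because the reaction is at least \<open>R/\<epsilon>\<close> on
  the levels between \<open>a \<epsilon>\<close> and \<open>b \<epsilon>\<close>: a paraboloid climbs through these levels within
  a distance of order \<open>\<epsilon>\<close> and continues as a cone (\<open>ramp\<close>). Hence \<open>u\<close> is of order \<open>r\<close> somewhere on the
  sphere of radius \<open>r\<close> comparable to \<open>d\<close> (\<open>perron_sphere_above_ramp\<close>), and the growth estimate
  transfers this to \<open>x\<^sub>0\<close> (\<open>perron_lower_bound_radius\<close>).

  Both bounds are proved for members of the Perron class that are close to \<open>u\<close> at one point or on
  one sphere. Since every member dominates \<open>u\<close>, it inherits \<open>w > \<epsilon>\<close> wherever \<open>u > \<epsilon>\<close>, and with it the
  bound \<open>C\<close> on the reaction.
\<close>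

section \<open>The infinity Laplacian as a one-dimensional second derivative\<close>

definition grad :: "('a::euclidean_space \<Rightarrow> real) \<Rightarrow> 'a \<Rightarrow> 'a" where
  "grad f x = (\<Sum>i\<in>Basis. partial_deriv i f x *\<^sub>R i)"

lemma grad_inner_Basis: "i \<in> Basis \<Longrightarrow> grad f x \<bullet> i = partial_deriv i f x"
  by (simp add: grad_def inner_sum_left inner_Basis if_distrib sum.delta cong: if_cong)

lemma partial_deriv_eqI:
  "(f has_derivative D) (at x) \<Longrightarrow> partial_deriv i f x = D i"
  unfolding partial_deriv_def by (metis frechet_derivative_at)

lemma has_derivative_grad:
  fixes f :: "'a::euclidean_space \<Rightarrow> real"
  assumes "f differentiable (at x)"
  shows "(f has_derivative (\<lambda>h. grad f x \<bullet> h)) (at x)"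
proof -
  obtain D where D: "(f has_derivative D) (at x)"
    using assms unfolding differentiable_def by blast
  have lin: "linear D"
    using D has_derivative_linear by blast
  have "D h = grad f x \<bullet> h" for h
  proof -
    have "D h = D (\<Sum>i\<in>Basis. (h \<bullet> i) *\<^sub>R i)"
      by (simp add: euclidean_representation)
    also have "\<dots> = (\<Sum>i\<in>Basis. (h \<bullet> i) * D i)"
      by (simp add: linear_sum[OF lin] linear_cmul[OF lin])
    also have "\<dots> = grad f x \<bullet> h"
      unfolding grad_def
      by (simp add: inner_sum_left inner_commute[of h] partial_deriv_eqI[OF D] mult.commute)
    finally show ?thesis .
  qed
  then show ?thesis
    using D by (metis (no_types, lifting) ext)
qed

lemma DERIV_along_line:
  fixes f :: "'a::euclidean_space \<Rightarrow> real"
  assumes "f differentiable (at (x + s *\<^sub>R v))"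
  shows "((\<lambda>s. f (x + s *\<^sub>R v)) has_real_derivative grad f (x + s *\<^sub>R v) \<bullet> v) (at s)"
proof -
  have "((\<lambda>s. x + s *\<^sub>R v) has_derivative (\<lambda>s. s *\<^sub>R v)) (at s)"
    by (auto intro!: derivative_eq_intros)
  from has_derivative_compose[OF this has_derivative_grad[OF assms]]
  show ?thesis
    unfolding has_field_derivative_def by (rule has_derivative_eq_rhs) (auto simp: fun_eq_iff)
qed

text \<open>Second-order test at a touching point from one-dimensional calculus alone. The derivative of
  \<open>h\<close> minus the parabola vanishes at \<open>0\<close>, so a positive derivative of it there would make that
  difference increase to the right of \<open>0\<close>.\<close>

lemma second_order_touching:
  fixes h h' :: "real \<Rightarrow> real"
  assumes d1: "\<forall>\<^sub>F s in nhds 0. (h has_real_derivative h' s) (at s)"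
    and d2: "(h' has_real_derivative l) (at 0)"
    and le: "\<forall>\<^sub>F s in nhds 0. h s \<le> h 0 + \<alpha> * s + q / 2 * s\<^sup>2"
  shows "l \<le> q"
proof (rule ccontr)
  assume "\<not> l \<le> q"
  define k where "k s = h s - \<alpha> * s - q / 2 * s\<^sup>2" for s
  define k' where "k' s = h' s - \<alpha> - q * s" for s
  obtain e where e: "0 < e"
      "\<And>s. \<bar>s\<bar> < e \<Longrightarrow> (h has_real_derivative h' s) (at s)"
      "\<And>s. \<bar>s\<bar> < e \<Longrightarrow> h s \<le> h 0 + \<alpha> * s + q / 2 * s\<^sup>2"
    using eventually_conj[OF d1 le] unfolding eventually_nhds_metric
    by (auto simp: dist_real_def)
  have dk: "(k has_real_derivative k' s) (at s)" if "\<bar>s\<bar> < e" for s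
    unfolding k_def k'_def using e(2)[OF that]
    by (auto intro!: derivative_eq_intros simp: power2_eq_square)
  have max: "k s \<le> k 0" if "\<bar>s\<bar> < e" for s
    using e(3)[OF that] by (simp add: k_def)
  have "k' 0 = 0"
    using DERIV_local_max[OF dk[of 0] e(1)] max e(1) by auto
  have "(k' has_real_derivative l - q) (at 0)"
    unfolding k'_def by (auto intro!: derivative_eq_intros d2)
  from DERIV_pos_inc_right[OF this] obtain d where
    d: "d > 0" "\<And>s. 0 < s \<Longrightarrow> s < d \<Longrightarrow> 0 < k' s"
    using \<open>\<not> l \<le> q\<close> \<open>k' 0 = 0\<close> by auto
  define s where "s = min d e / 2"
  have s: "0 < s" "s < d" "s < e"
    using d(1) e(1) by (auto simp: s_def min_def)
  have "k 0 < k s"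
  proof (rule DERIV_pos_imp_increasing_open[OF s(1)])
    show "\<exists>y. (k has_real_derivative y) (at x) \<and> 0 < y" if "0 < x" "x < s" for x
      using dk[of x] d(2)[of x] that s by auto
    show "continuous_on {0..s} k"
      using dk s by (intro DERIV_continuous_on[of _ _ k']) (auto intro: has_field_derivative_at_within)
  qed
  with max[of s] s show False by auto
qed

text \<open>\<open>\<Delta>\<^sub>\<infinity>\<phi>(x)\<close> is the second derivative of \<open>\<phi>\<close> at \<open>x\<close> along the single line through \<open>x\<close> with direction
  \<open>D\<phi>(x)\<close>. Hence a function that touches \<open>\<phi>\<close> from above, even a non-smooth one such as a cone, has
  to be examined on that line only.\<close>

lemma inf_laplacian_le_along_gradient:
  fixes \<phi> :: "'a::euclidean_space \<Rightarrow> real"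
  assumes "open S" "Ck_on 2 S \<phi>" "x \<in> S"
    and le: "\<forall>\<^sub>F s in nhds 0. \<phi> (x + s *\<^sub>R grad \<phi> x) \<le> \<phi> x + \<alpha> * s + q / 2 * s\<^sup>2"
  shows "inf_laplacian \<phi> x \<le> q"
proof -
  define v where "v = grad \<phi> x"
  have dif: "\<phi> differentiable (at y)" if "y \<in> S" for y
    using assms(2) that by (simp add: numeral_2_eq_2)
  have dif2: "partial_deriv i \<phi> differentiable (at y)" if "y \<in> S" "i \<in> Basis" for y i
    using assms(2) that by (simp add: numeral_2_eq_2)
  have ev: "\<forall>\<^sub>F s in nhds 0. x + s *\<^sub>R v \<in> S"
  proof -
    have "open ((\<lambda>s. x + s *\<^sub>R v) -` S)"
      using assms(1) by (intro open_vimage continuous_intros)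
    then show ?thesis
      unfolding eventually_nhds using assms(3) by force
  qed
  have "((\<lambda>s. \<phi> (x + s *\<^sub>R v)) has_real_derivative grad \<phi> (x + s *\<^sub>R v) \<bullet> v) (at s)"
    if "x + s *\<^sub>R v \<in> S" for s
    using DERIV_along_line[OF dif[OF that]] .
  then have d1: "\<forall>\<^sub>F s in nhds 0. ((\<lambda>s. \<phi> (x + s *\<^sub>R v)) has_real_derivative
      grad \<phi> (x + s *\<^sub>R v) \<bullet> v) (at s)"
    by (rule eventually_mono[OF ev])
  have part: "((\<lambda>s. partial_deriv i \<phi> (x + s *\<^sub>R v)) has_real_derivative
      grad (partial_deriv i \<phi>) x \<bullet> v) (at 0)" if "i \<in> Basis" for i
    using DERIV_along_line[of "partial_deriv i \<phi>" x 0 v] dif2[OF assms(3) that] by simp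
  have "((\<lambda>s. \<Sum>i\<in>Basis. (v \<bullet> i) * partial_deriv i \<phi> (x + s *\<^sub>R v)) has_real_derivative
      (\<Sum>i\<in>Basis. (v \<bullet> i) * (grad (partial_deriv i \<phi>) x \<bullet> v))) (at 0)"
    by (intro DERIV_sum DERIV_cmult part)
  moreover have "grad \<phi> y \<bullet> v = (\<Sum>i\<in>Basis. (v \<bullet> i) * partial_deriv i \<phi> y)" for y
    by (simp add: grad_def inner_sum_left inner_commute[of v] mult.commute)
  moreover have "(\<Sum>i\<in>Basis. (v \<bullet> i) * (grad (partial_deriv i \<phi>) x \<bullet> v)) = inf_laplacian \<phi> x"
    unfolding inf_laplacian_def
  proof (rule sum.cong[OF refl])
    fix i :: 'a assume i: "i \<in> Basis"
    have "grad (partial_deriv i \<phi>) x \<bullet> v =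
        (\<Sum>j\<in>Basis. partial_deriv j (partial_deriv i \<phi>) x * partial_deriv j \<phi> x)"
      unfolding grad_def[of "partial_deriv i \<phi>"] inner_sum_left v_def
    proof (rule sum.cong[OF refl])
      fix j :: 'a assume "j \<in> Basis"
      then have "j \<bullet> grad \<phi> x = partial_deriv j \<phi> x"
        by (metis grad_inner_Basis inner_commute)
      then show "partial_deriv j (partial_deriv i \<phi>) x *\<^sub>R j \<bullet> grad \<phi> x =
          partial_deriv j (partial_deriv i \<phi>) x * partial_deriv j \<phi> x"
        by simp
    qed
    then show "(v \<bullet> i) * (grad (partial_deriv i \<phi>) x \<bullet> v) = (\<Sum>j\<in>Basis.
        partial_deriv i \<phi> x * partial_deriv j \<phi> x * partial_deriv j (partial_deriv i \<phi>) x)"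
      by (simp add: v_def grad_inner_Basis[OF i] sum_distrib_left algebra_simps)
  qed
  ultimately have d2: "((\<lambda>s. grad \<phi> (x + s *\<^sub>R v) \<bullet> v) has_real_derivative inf_laplacian \<phi> x) (at 0)"
    by simp
  show ?thesis
    using second_order_touching[OF d1 d2, of \<alpha> q] le by (simp add: v_def)
qed

text \<open>Identifies the line on which \<open>inf_laplacian_le_along_gradient\<close> is applied when the upper barrier is radial.\<close>

lemma grad_touching_paraboloid:
  fixes \<phi> :: "'a::euclidean_space \<Rightarrow> real"
  assumes "\<phi> differentiable (at x)"
    and "\<forall>\<^sub>F y in nhds x. \<phi> y \<le> \<phi> x + \<beta> * ((y - c) \<bullet> (y - c) - (x - c) \<bullet> (x - c))"
  shows "grad \<phi> x = (2 * \<beta>) *\<^sub>R (x - c)"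
proof -
  obtain e where e: "0 < e"
      "\<And>y. dist y x < e \<Longrightarrow> \<phi> y \<le> \<phi> x + \<beta> * ((y - c) \<bullet> (y - c) - (x - c) \<bullet> (x - c))"
    using assms(2) unfolding eventually_nhds_metric by blast
  define f where "f y = \<phi> y - \<beta> * ((y - c) \<bullet> (y - c))" for y
  have d: "(f has_derivative (\<lambda>h. grad \<phi> x \<bullet> h - \<beta> * (2 * ((x - c) \<bullet> h)))) (at x)"
    unfolding f_def
    by (auto intro!: derivative_eq_intros has_derivative_grad[OF assms(1)] simp: inner_commute algebra_simps)
  have "(\<lambda>h. grad \<phi> x \<bullet> h - \<beta> * (2 * ((x - c) \<bullet> h))) = (\<lambda>h. 0)"
    by (rule differential_zero_maxmin[of x "ball x e" f])
      (use d e in \<open>auto simp: f_def dist_commute algebra_simps\<close>)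
  then have "grad \<phi> x \<bullet> h - \<beta> * (2 * ((x - c) \<bullet> h)) = 0" for h
    by meson
  then have "(grad \<phi> x - (2 * \<beta>) *\<^sub>R (x - c)) \<bullet> h = 0" for h
    by (simp add: algebra_simps)
  then show ?thesis
    by (metis eq_iff_diff_eq_0 inner_eq_zero_iff)
qed

section \<open>Radial test functions\<close>

text \<open>All test functions that are inserted into a viscosity inequality below have this form. As
  polynomials they are \<open>C\<^sup>2\<close> on all of \<open>\<Omega>\<close>, which the definition of viscosity solution requires and
  which cones and roots of \<open>|x - c|\<close> violate at the centre. The offset \<open>k\<close> is the value of
  \<open>|x - c|\<^sup>2\<close> at the touching point, so that \<open>\<alpha>\<close>, \<open>\<beta>\<close> and \<open>2 \<gamma>\<close> are the value and the derivatives there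
  with respect to \<open>|x - c|\<^sup>2\<close>.\<close>

definition radial_quartic :: "'a::euclidean_space \<Rightarrow> real \<Rightarrow> real \<Rightarrow> real \<Rightarrow> real \<Rightarrow> 'a \<Rightarrow> real" where
  "radial_quartic c k \<alpha> \<beta> \<gamma> x =
     \<alpha> + \<beta> * ((x - c) \<bullet> (x - c) - k) + \<gamma> * ((x - c) \<bullet> (x - c) - k)\<^sup>2"

lemma radial_quartic_derivatives:
  fixes c :: "'a::euclidean_space" and k \<beta> \<gamma> :: real
  defines "G \<equiv> \<lambda>x. \<beta> + 2 * \<gamma> * ((x - c) \<bullet> (x - c) - k)"
  shows "(radial_quartic c k \<alpha> \<beta> \<gamma> has_derivative (\<lambda>h. 2 * G x * ((x - c) \<bullet> h))) (at x)"
    and "partial_deriv i (radial_quartic c k \<alpha> \<beta> \<gamma>) = (\<lambda>x. 2 * G x * ((x - c) \<bullet> i))"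
    and "((\<lambda>x. 2 * G x * ((x - c) \<bullet> i)) has_derivative
      (\<lambda>h. 2 * G x * (h \<bullet> i) + 8 * \<gamma> * ((x - c) \<bullet> h) * ((x - c) \<bullet> i))) (at x)"
    and "partial_deriv j (\<lambda>x. 2 * G x * ((x - c) \<bullet> i)) =
      (\<lambda>x. 2 * G x * (j \<bullet> i) + 8 * \<gamma> * ((x - c) \<bullet> j) * ((x - c) \<bullet> i))"
proof -
  show 1: "(radial_quartic c k \<alpha> \<beta> \<gamma> has_derivative (\<lambda>h. 2 * G x * ((x - c) \<bullet> h))) (at x)" for x
    unfolding radial_quartic_def G_def
    by (rule has_derivative_eq_rhs, (rule derivative_intros)+)
      (auto simp: fun_eq_iff algebra_simps inner_commute)
  show "partial_deriv i (radial_quartic c k \<alpha> \<beta> \<gamma>) = (\<lambda>x. 2 * G x * ((x - c) \<bullet> i))"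
    using partial_deriv_eqI[OF 1] by blast
  show 2: "((\<lambda>x. 2 * G x * ((x - c) \<bullet> i)) has_derivative
      (\<lambda>h. 2 * G x * (h \<bullet> i) + 8 * \<gamma> * ((x - c) \<bullet> h) * ((x - c) \<bullet> i))) (at x)" for x
    unfolding G_def
    by (rule has_derivative_eq_rhs, (rule derivative_intros)+)
      (auto simp: fun_eq_iff algebra_simps inner_commute)
  show "partial_deriv j (\<lambda>x. 2 * G x * ((x - c) \<bullet> i)) =
      (\<lambda>x. 2 * G x * (j \<bullet> i) + 8 * \<gamma> * ((x - c) \<bullet> j) * ((x - c) \<bullet> i))"
    using partial_deriv_eqI[OF 2] by blast
qed

lemma Ck_on_radial_quartic: "Ck_on 2 S (radial_quartic c k \<alpha> \<beta> \<gamma>)"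
  unfolding numeral_2_eq_2 Ck_on.simps radial_quartic_derivatives(2,4)
  by (auto intro!: continuous_intros differentiableI[OF radial_quartic_derivatives(1)]
      differentiableI[OF radial_quartic_derivatives(3)])

lemma inf_laplacian_radial_quartic:
  fixes c x :: "'a::euclidean_space" and k \<beta> \<gamma> G :: real
  defines "q \<equiv> (x - c) \<bullet> (x - c)"
  assumes "G = \<beta> + 2 * \<gamma> * (q - k)"
  shows "inf_laplacian (radial_quartic c k \<alpha> \<beta> \<gamma>) x = 8 * G\<^sup>2 * q * (G + 4 * \<gamma> * q)"
proof -
  define y where "y = x - c"
  have q: "q = (\<Sum>i\<in>Basis. (y \<bullet> i)\<^sup>2)"
    unfolding q_def y_def by (subst euclidean_inner) (simp add: power2_eq_square)
  have G: "\<beta> + 2 * \<gamma> * ((x - c) \<bullet> (x - c) - k) = G"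
    using assms by simp
  have "inf_laplacian (radial_quartic c k \<alpha> \<beta> \<gamma>) x =
    (\<Sum>i\<in>Basis. \<Sum>j\<in>Basis. (2 * G * (y \<bullet> i)) * (2 * G * (y \<bullet> j)) *
       (2 * G * (j \<bullet> i) + 8 * \<gamma> * (y \<bullet> j) * (y \<bullet> i)))"
    unfolding inf_laplacian_def radial_quartic_derivatives(2,4) G by (simp add: y_def)
  also have "\<dots> = (\<Sum>i\<in>Basis. \<Sum>j\<in>Basis. (if j = i then 8 * G^3 * (y \<bullet> i)\<^sup>2 else 0) +
       32 * G\<^sup>2 * \<gamma> * ((y \<bullet> i)\<^sup>2 * (y \<bullet> j)\<^sup>2))"
    by (intro sum.cong refl) (auto simp: inner_Basis algebra_simps power2_eq_square power3_eq_cube)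
  also have "\<dots> = 8 * G^3 * q + 32 * G\<^sup>2 * \<gamma> * (q * q)"
    unfolding q sum_product by (simp add: sum.distrib sum.delta sum_distrib_left)
  also have "\<dots> = 8 * G\<^sup>2 * q * (G + 4 * \<gamma> * q)"
    by (simp add: algebra_simps power2_eq_square power3_eq_cube)
  finally show ?thesis .
qed

section \<open>Growth of nonnegative supersolutions\<close>

lemma viscosity_supersolutionD:
  assumes "viscosity_supersolution \<Omega> f u" "Ck_on 2 \<Omega> \<phi>" "x \<in> \<Omega>" "\<phi> x = u x"
    and "\<forall>\<^sub>F y in nhds x. \<phi> y \<le> u y"
  shows "inf_laplacian \<phi> x \<le> f x (u x)"
proof -
  have "\<forall>\<^sub>F y in nhds x. u y - \<phi> y \<ge> u x - \<phi> x"
    using assms(5) by eventually_elim (simp add: assms(4))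
  then have "inf_laplacian \<phi> x \<le> f x (\<phi> x)"
    using assms(1-4) unfolding viscosity_supersolution_def by blast
  then show ?thesis
    by (simp add: assms(4))
qed

lemma viscosity_subsolutionD:
  assumes "viscosity_subsolution \<Omega> f u" "Ck_on 2 \<Omega> \<phi>" "x \<in> \<Omega>" "\<phi> x = u x"
    and "\<forall>\<^sub>F y in nhds x. u y \<le> \<phi> y"
  shows "f x (u x) \<le> inf_laplacian \<phi> x"
proof -
  have "\<forall>\<^sub>F y in nhds x. u y - \<phi> y \<le> u x - \<phi> x"
    using assms(5) by eventually_elim (simp add: assms(4))
  then have "f x (\<phi> x) \<le> inf_laplacian \<phi> x"
    using assms(1-4) unfolding viscosity_subsolution_def by blast
  then show ?thesis
    by (simp add: assms(4))
qed

text \<open>The Taylor polynomial of \<open>y\<^sup>1\<^sup>/\<^sup>4\<close> at \<open>1\<close> is \<open>1 + (y - 1)/4 - 3/32 (y - 1)\<^sup>2\<close>. Decreasing the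
  coefficient \<open>3/32 = 6/64\<close> to \<open>5/64\<close> gives a polynomial above the root near \<open>1\<close>; it is written here
  with \<open>y = z\<^sup>4\<close>. Any coefficient above \<open>4/64\<close> leaves the barrier of the next lemma a strict
  subsolution.\<close>

lemma fourth_root_below_quadratic:
  "\<forall>\<^sub>F z::real in nhds 1. z - 1 \<le> (z^4 - 1) / 4 - 5 / 64 * (z^4 - 1)\<^sup>2"
proof -
  define F :: "real \<Rightarrow> real" where "F z = (z\<^sup>2 + 2 * z + 3) / 4 - 5 / 64 * (z^3 + z\<^sup>2 + z + 1)\<^sup>2" for z
  have "open {z. 0 < F z}"
    unfolding F_def by (intro open_Collect_less continuous_intros) auto
  moreover have "1 \<in> {z. 0 < F z}"
    by (simp add: F_def)
  ultimately have "\<forall>\<^sub>F z in nhds 1. 0 < F z"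
    unfolding eventually_nhds by blast
  then show ?thesis
  proof eventually_elim
    case (elim z)
    have "(z^4 - 1) / 4 - 5 / 64 * (z^4 - 1)\<^sup>2 - (z - 1) = (z - 1)\<^sup>2 * F z"
      unfolding F_def by (simp add: field_simps power2_eq_square power3_eq_cube power4_eq_xxxx)
    also have "\<dots> \<ge> 0"
      using elim by simp
    finally show ?case by simp
  qed
qed

text \<open>The value at the centre alone controls a nonnegative supersolution in the whole ball, with a bound
  that vanishes only linearly at the sphere. The barrier
  \<open>u(c) (1 - (|x - c|/r)\<^sup>1\<^sup>/\<^sup>2)\<close> is at most \<open>u\<close> at \<open>c\<close> and on the sphere, and away from \<open>c\<close> it satisfies
  \<open>\<Delta>\<^sub>\<infinity> \<ge> u(c)\<^sup>3/(16 r\<^sup>4)\<close>; its singular point \<open>c\<close> cannot be a negative minimum of the difference. At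
  such a minimum the barrier is replaced by a polynomial below it, which costs a factor two in
  \<open>\<Delta>\<^sub>\<infinity>\<close> and explains the constant \<open>32\<close>.\<close>

lemma supersolution_growth_from_centre:
  fixes u :: "'a::euclidean_space \<Rightarrow> real"
  assumes super: "viscosity_supersolution \<Omega> f u"
    and ball: "cball c r \<subseteq> \<Omega>" and r: "0 < r"
    and nonneg: "\<And>x. x \<in> cball c r \<Longrightarrow> 0 \<le> u x"
    and f: "\<And>x. x \<in> ball c r \<Longrightarrow> f x (u x) \<le> M"
    and M: "32 * M * r^4 < (u c)^3"
    and x: "x \<in> cball c r"
  shows "u c * (1 - sqrt (dist c x / r)) \<le> u x"
proof (cases "u c = 0")
  case True
  then show ?thesis using nonneg x by simp
next
  case False
  define m where "m = u c"
  have m: "0 < m"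
    using False nonneg[of c] r by (simp add: m_def)
  define w where "w x = m * (1 - sqrt (dist c x / r))" for x
  have cont: "continuous_on (cball c r) (\<lambda>x. u x - w x)"
    using super ball unfolding viscosity_supersolution_def w_def
    by (intro continuous_intros) (auto intro: continuous_on_subset simp: r less_imp_neq[symmetric])
  obtain p where p: "p \<in> cball c r" "\<And>y. y \<in> cball c r \<Longrightarrow> u p - w p \<le> u y - w y"
    using continuous_attains_inf[OF compact_cball _ cont] r by auto
  have "0 \<le> u p - w p"
  proof (rule ccontr)
    assume neg: "\<not> 0 \<le> u p - w p"
    have "p \<noteq> c"
      using neg by (auto simp: w_def m_def)
    have "w p = 0" if "dist c p = r"
      using that r by (simp add: w_def)
    with neg nonneg[OF p(1)] p(1) have pb: "p \<in> ball c r"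
      by force
    define d where "d = dist c p"
    define k where "k = d\<^sup>2"
    define z where "z = sqrt (d / r)"
    have d: "0 < d" "d < r"
      using \<open>p \<noteq> c\<close> pb by (auto simp: d_def)
    have z: "0 < z" "z \<le> 1" and dz: "d = z\<^sup>2 * r"
      using d r by (auto simp: z_def)
    have k: "0 < k" "(p - c) \<bullet> (p - c) = k"
      using d by (auto simp: k_def d_def dist_norm norm_minus_commute dot_square_norm)
    \<comment> \<open>The lower polynomial of the barrier at \<open>p\<close>, with \<open>y = |x - c|\<^sup>2 / k\<close> in
      \<open>fourth_root_below_quadratic\<close>; the factor \<open>m z\<close> is the drop of the barrier between \<open>c\<close> and \<open>p\<close>.\<close>
    define T where "T = radial_quartic c k (u p) (- (m * z / (4 * k))) (5 * m * z / (64 * k\<^sup>2))"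
    have "\<forall>\<^sub>F y in nhds p. T y \<le> u y"
    proof -
      have "isCont (\<lambda>y. sqrt (dist c y / d)) p"
        using d by (intro continuous_intros) auto
      then have "((\<lambda>y. sqrt (dist c y / d)) \<longlongrightarrow> sqrt (dist c p / d)) (nhds p)"
        using tendsto_at_iff_tendsto_nhds[of "\<lambda>y. sqrt (dist c y / d)" p] by (simp add: isCont_def)
      then have "((\<lambda>y. sqrt (dist c y / d)) \<longlongrightarrow> 1) (nhds p)"
        using d by (simp add: d_def)
      then have "\<forall>\<^sub>F y in nhds p. sqrt (dist c y / d) - 1 \<le>
          ((sqrt (dist c y / d))^4 - 1) / 4 - 5 / 64 * ((sqrt (dist c y / d))^4 - 1)\<^sup>2"
        by (rule eventually_compose_filterlim[OF fourth_root_below_quadratic])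
      moreover have "\<forall>\<^sub>F y in nhds p. y \<in> ball c r"
        using eventually_nhds_in_open[OF open_ball pb] .
      ultimately show ?thesis
      proof eventually_elim
        case (elim y)
        define Z where "Z = sqrt (dist c y / d)"
        have Z4: "Z^4 = ((y - c) \<bullet> (y - c)) / k"
        proof -
          have "Z^4 = (Z\<^sup>2)\<^sup>2" by simp
          also have "Z\<^sup>2 = dist c y / d" using d by (simp add: Z_def)
          finally show ?thesis
            by (simp add: power_divide k_def dist_norm norm_minus_commute dot_square_norm)
        qed
        have "sqrt (dist c y / r) = z * Z"
          using d r by (simp add: z_def Z_def real_sqrt_mult[symmetric])
        then have "w y - w p = - (m * z * (Z - 1))"
          unfolding w_def by (simp add: z_def d_def algebra_simps)
        moreover have "T y = u p - m * z * ((Z^4 - 1) / 4 - 5 / 64 * (Z^4 - 1)\<^sup>2)"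
          unfolding T_def radial_quartic_def Z4 using k(1)
          by (simp add: field_simps power2_eq_square)
        moreover have "m * z * (Z - 1) \<le> m * z * ((Z^4 - 1) / 4 - 5 / 64 * (Z^4 - 1)\<^sup>2)"
          using elim(1) m z(1) unfolding Z_def by (intro mult_left_mono) auto
        moreover have "u p - w p \<le> u y - w y"
          using p(2) elim(2) by auto
        ultimately show ?case by linarith
      qed
    qed
    then have "inf_laplacian T p \<le> f p (u p)"
      using p(1) ball k(2)
      by (intro viscosity_supersolutionD[OF super]) (auto simp: T_def radial_quartic_def Ck_on_radial_quartic)
    also have "\<dots> \<le> M"
      using f pb by blast
    finally have "inf_laplacian T p \<le> M" .
    moreover have "inf_laplacian T p = (m * z)^3 / (32 * k\<^sup>2)"
      unfolding T_def using k
      by (subst inf_laplacian_radial_quartic[of "- (m * z / (4 * k))"])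
        (auto simp: field_simps power2_eq_square power3_eq_cube)
    moreover have "M < m^3 / (32 * r^4)"
      using M r by (simp add: m_def field_simps)
    moreover have "m^3 / (32 * r^4) \<le> (m * z)^3 / (32 * k\<^sup>2)"
    proof -
      have "k\<^sup>2 = z^8 * r^4"
        by (simp add: k_def dz power_mult_distrib flip: power_mult)
      also have "\<dots> \<le> z^3 * r^4"
        using z r by (intro mult_right_mono power_decreasing) auto
      finally have "k\<^sup>2 * m^3 \<le> (z^3 * r^4) * m^3"
        using m by (intro mult_right_mono) auto
      then show ?thesis
        using k(1) r by (simp add: field_simps power_mult_distrib)
    qed
    ultimately show False by linarith
  qed
  then show ?thesis
    using p(2)[OF x] by (simp add: w_def m_def)
qed

text \<open>The form used at scales at which \<open>M r\<close> stays bounded: there the cubic condition follows from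
  \<open>u(c)\<close> exceeding a fixed multiple of \<open>r\<close>.\<close>

corollary supersolution_growth_at_linear_height:
  fixes u :: "'a::euclidean_space \<Rightarrow> real"
  assumes super: "viscosity_supersolution \<Omega> f u"
    and ball: "cball c r \<subseteq> \<Omega>" and r: "0 < r"
    and nonneg: "\<And>x. x \<in> cball c r \<Longrightarrow> 0 \<le> u x"
    and f: "\<And>x. x \<in> ball c r \<Longrightarrow> f x (u x) \<le> M"
    and L: "1 \<le> L" "32 * (M * r) \<le> L" "L * r < u c"
    and x: "x \<in> cball c r"
  shows "u c * (1 - sqrt (dist c x / r)) \<le> u x"
proof (rule supersolution_growth_from_centre[OF super ball r nonneg f _ x])
  have "32 * M * r^4 = 32 * (M * r) * r^3"
    by (simp add: power_eq_if)
  also have "\<dots> \<le> L * r^3"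
    using L(2) r by (intro mult_right_mono) auto
  also have "\<dots> \<le> L^3 * r^3"
    using L(1) r by (intro mult_right_mono self_le_power) auto
  also have "\<dots> < (u c)^3"
    using L r by (subst power_mult_distrib[symmetric]) (intro power_strict_mono, auto)
  finally show "32 * M * r^4 < (u c)^3" .
qed

text \<open>A concave paraboloid has negative infinity Laplacian except at its vertex. Its vertex is placed
  outside \<open>\<Omega>\<close>, and it is so flat that a value of \<open>v\<close> above \<open>A\<close> still forces the
  difference of \<open>v\<close> and the paraboloid to have an interior maximum.\<close>

lemma subsolution_le_boundary_bound:
  fixes v :: "'a::euclidean_space \<Rightarrow> real"
  assumes \<Omega>: "open \<Omega>" "bounded \<Omega>" and sub: "viscosity_subsolution \<Omega> (\<lambda>_ _. 0) v"
    and cont: "continuous_on (closure \<Omega>) v"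
    and bd: "\<And>x. x \<in> frontier \<Omega> \<Longrightarrow> v x \<le> A"
    and x: "x \<in> \<Omega>"
  shows "v x \<le> A"
proof (rule ccontr)
  assume "\<not> v x \<le> A"
  have "\<Omega> \<noteq> UNIV"
    using \<Omega>(2) not_bounded_UNIV by auto
  then obtain p where p: "p \<notin> \<Omega>"
    by blast
  have "bounded (closure \<Omega>)"
    using \<Omega>(2) by (rule bounded_closure)
  then obtain N where N: "\<And>y. y \<in> closure \<Omega> \<Longrightarrow> dist p y \<le> N"
    unfolding bounded_any_center[where a = p] by blast
  have "0 < dist p x" "dist p x \<le> N"
    using N[of x] x p closure_subset[of \<Omega>] by auto
  then have "0 < N"
    by linarith
  have xc: "x \<in> closure \<Omega>"
    using x closure_subset by blast
  define \<kappa> where "\<kappa> = (v x - A) / (2 * N\<^sup>2)"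
  have \<kappa>: "0 < \<kappa>" "\<kappa> * N\<^sup>2 < v x - A"
    using \<open>\<not> v x \<le> A\<close> \<open>0 < N\<close> by (auto simp: \<kappa>_def)
  have cont': "continuous_on (closure \<Omega>) (\<lambda>y. v y + \<kappa> * ((y - p) \<bullet> (y - p)))"
    by (intro continuous_intros cont)
  have "compact (closure \<Omega>)" "closure \<Omega> \<noteq> {}"
    using \<Omega>(2) xc by auto
  from continuous_attains_sup[OF this cont'] obtain z where z: "z \<in> closure \<Omega>"
    "\<And>y. y \<in> closure \<Omega> \<Longrightarrow> v y + \<kappa> * ((y - p) \<bullet> (y - p)) \<le> v z + \<kappa> * ((z - p) \<bullet> (z - p))"
    by auto
  have "z \<in> \<Omega>"
  proof (rule ccontr)
    assume "z \<notin> \<Omega>"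
    then have "v z \<le> A"
      using bd[of z] z(1) \<Omega>(1) by (simp add: frontier_def interior_open)
    have "(z - p) \<bullet> (z - p) = (dist p z)\<^sup>2"
      by (simp add: dist_norm norm_minus_commute dot_square_norm)
    also have "\<dots> \<le> N\<^sup>2"
      using N[OF z(1)] by (intro power_mono) auto
    finally have "\<kappa> * ((z - p) \<bullet> (z - p)) \<le> \<kappa> * N\<^sup>2"
      using \<kappa>(1) by simp
    moreover have "v x + \<kappa> * ((x - p) \<bullet> (x - p)) \<le> v z + \<kappa> * ((z - p) \<bullet> (z - p))"
      using z(2) xc by blast
    moreover have "0 \<le> \<kappa> * ((x - p) \<bullet> (x - p))"
      using \<kappa>(1) by simp
    ultimately show False
      using \<open>v z \<le> A\<close> \<kappa>(2) by linarith
  qed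
  define T where "T = radial_quartic p ((z - p) \<bullet> (z - p)) (v z) (- \<kappa>) 0"
  have "\<forall>\<^sub>F y in nhds z. v y \<le> T y" 
  proof -
    have "v y \<le> T y" if "y \<in> \<Omega>" for y
      using z(2)[of y] that closure_subset[of \<Omega>]
      by (auto simp: T_def radial_quartic_def right_diff_distrib)
    then show ?thesis
      using eventually_nhds_in_open[OF \<Omega>(1) \<open>z \<in> \<Omega>\<close>] by (auto elim: eventually_mono)
  qed
  then have "0 \<le> inf_laplacian T z"
    by (intro viscosity_subsolutionD[OF sub _ \<open>z \<in> \<Omega>\<close>]) (auto simp: T_def radial_quartic_def Ck_on_radial_quartic)
  also have "inf_laplacian T z = - 8 * \<kappa>^3 * ((z - p) \<bullet> (z - p))"
    unfolding T_def by (subst inf_laplacian_radial_quartic[of "- \<kappa>"]) (auto simp: power2_eq_square power3_eq_cube)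
  also have "\<dots> < 0"
  proof -
    have "z \<noteq> p"
      using p \<open>z \<in> \<Omega>\<close> by blast
    then have "0 < (z - p) \<bullet> (z - p)"
      by simp
    with \<kappa>(1) show ?thesis
      by simp
  qed
  finally show False by simp
qed

section \<open>A radial barrier that uses the reaction\<close>

text \<open>A paraboloid on the ball of radius \<open>t e\<close> about \<open>c\<close> and a cone outside it. Inside, it climbs from
  \<open>0\<close> to \<open>\<kappa> t\<^sup>2 e\<close> with an infinity Laplacian of order \<open>1/e\<close>, which a reaction of size \<open>1/e\<close> can pay for;
  there its slope reaches \<open>2 \<kappa> t\<close>, independently of \<open>e\<close>. The cone goes on with the slope \<open>\<kappa> t\<close> of the
  chord of the paraboloid, so that the kink is concave and the function is a minimum of the two. Its
  infinity Laplacian is zero, so that a nonnegative reaction suffices at higher levels.\<close>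

definition ramp :: "'a::euclidean_space \<Rightarrow> real \<Rightarrow> real \<Rightarrow> real \<Rightarrow> 'a \<Rightarrow> real" where
  "ramp c e \<kappa> t x = min (\<kappa> / e * ((x - c) \<bullet> (x - c))) (\<kappa> * t * norm (x - c))"

lemma continuous_on_ramp [continuous_intros]: "continuous_on S (ramp c e \<kappa> t)"
  unfolding ramp_def by (intro continuous_intros)

lemma ramp_centre [simp]: "ramp c e \<kappa> t c = 0"
  by (simp add: ramp_def)

lemma ramp_nonneg: "0 < e \<Longrightarrow> 0 < \<kappa> \<Longrightarrow> 0 < t \<Longrightarrow> 0 \<le> ramp c e \<kappa> t x"
  by (simp add: ramp_def)

lemma ramp_inner:
  assumes "0 < e" "0 < \<kappa>" "0 < t" "norm (x - c) \<le> t * e"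
  shows "ramp c e \<kappa> t x = \<kappa> / e * ((x - c) \<bullet> (x - c))"
proof -
  have "\<kappa> / e * norm (x - c) * norm (x - c) \<le> \<kappa> / e * (t * e) * norm (x - c)"
    using assms by (intro mult_right_mono mult_left_mono) auto
  then show ?thesis
    using assms(1) by (simp add: ramp_def dot_square_norm power2_eq_square mult.assoc)
qed

lemma ramp_outer:
  assumes "0 < e" "0 < \<kappa>" "0 < t" "t * e \<le> norm (x - c)"
  shows "ramp c e \<kappa> t x = \<kappa> * t * norm (x - c)"
proof -
  have "\<kappa> / e * (t * e) * norm (x - c) \<le> \<kappa> / e * norm (x - c) * norm (x - c)"
    using assms by (intro mult_right_mono mult_left_mono) auto
  then show ?thesis
    using assms(1) by (simp add: ramp_def dot_square_norm power2_eq_square mult.assoc)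
qed

text \<open>The coefficient of \<open>|y - c|\<^sup>2\<close> in the paraboloid that touches the ramp from above at \<open>x\<close>; on the
  cone it comes from \<open>2 n m \<le> n\<^sup>2 + m\<^sup>2\<close>.\<close>

definition ramp_opening :: "'a::euclidean_space \<Rightarrow> real \<Rightarrow> real \<Rightarrow> real \<Rightarrow> 'a \<Rightarrow> real" where
  "ramp_opening c e \<kappa> t x = (if norm (x - c) \<le> t * e then \<kappa> / e else \<kappa> * t / (2 * norm (x - c)))"

lemma ramp_le_paraboloid:
  assumes "0 < e" "0 < \<kappa>" "0 < t"
  shows "ramp c e \<kappa> t y \<le>
    ramp c e \<kappa> t x + ramp_opening c e \<kappa> t x * ((y - c) \<bullet> (y - c) - (x - c) \<bullet> (x - c))"
proof (cases "norm (x - c) \<le> t * e")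
  case True
  then show ?thesis
    unfolding ramp_inner[OF assms True] ramp_opening_def by (simp add: ramp_def algebra_simps)
next
  case False
  define n m where "n = norm (x - c)" and "m = norm (y - c)"
  have n: "0 < n"
    using False mult_pos_pos[OF assms(3,1)] unfolding n_def by linarith
  have "0 \<le> \<kappa> * t / (2 * n) * (m - n)\<^sup>2"
    using n assms by simp
  also have "\<dots> = \<kappa> * t * n + \<kappa> * t / (2 * n) * (m\<^sup>2 - n\<^sup>2) - \<kappa> * t * m"
    using n by (simp add: field_simps power2_eq_square)
  finally have "\<kappa> * t * m \<le> \<kappa> * t * n + \<kappa> * t / (2 * n) * (m\<^sup>2 - n\<^sup>2)"
    by simp
  moreover have "ramp c e \<kappa> t y \<le> \<kappa> * t * m"
    by (simp add: ramp_def m_def)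
  moreover have "ramp c e \<kappa> t x = \<kappa> * t * n"
    unfolding n_def using False by (intro ramp_outer assms) auto
  ultimately show ?thesis
    using False by (simp add: ramp_opening_def dot_square_norm n_def m_def)
qed

lemma ramp_opening_laplacian:
  assumes "0 < e" "0 < \<kappa>" "0 < t"
  shows "8 * (ramp_opening c e \<kappa> t x)^3 * ((x - c) \<bullet> (x - c)) \<le> 8 * \<kappa>^3 * t\<^sup>2 / e"
proof (cases "norm (x - c) \<le> t * e")
  case True
  have "8 * (\<kappa> / e)^3 * (norm (x - c))\<^sup>2 \<le> 8 * (\<kappa> / e)^3 * (t * e)\<^sup>2"
    using True assms by (intro mult_left_mono power_mono) auto
  also have "\<dots> = 8 * \<kappa>^3 * t\<^sup>2 / e"
    using assms by (simp add: field_simps power2_eq_square power3_eq_cube)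
  finally show ?thesis
    using True by (simp add: ramp_opening_def dot_square_norm)
next
  case False
  define n where "n = norm (x - c)"
  have n: "t * e < n" "0 < n"
    using False mult_pos_pos[OF assms(3,1)] unfolding n_def by linarith+
  have "8 * (\<kappa> * t / (2 * n))^3 * n\<^sup>2 = \<kappa>^3 * t^3 / n"
    using n by (simp add: field_simps power2_eq_square power3_eq_cube)
  also have "\<dots> \<le> \<kappa>^3 * t^3 / (t * e)"
    using n assms by (intro divide_left_mono) auto
  also have "\<dots> = \<kappa>^3 * t\<^sup>2 / e"
    using assms by (simp add: field_simps power2_eq_square power3_eq_cube)
  also have "\<dots> \<le> 8 * \<kappa>^3 * t\<^sup>2 / e"
    using assms by (intro divide_right_mono mult_right_mono) auto
  finally show ?thesis
    using False by (simp add: ramp_opening_def dot_square_norm n_def)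
qed

text \<open>Comparison of the ramp with a subsolution whose right-hand side exceeds the infinity Laplacian of
  every touching paraboloid: at an interior maximum of the difference such a paraboloid is a
  forbidden test function.\<close>

lemma subsolution_le_ramp:
  fixes v :: "'a::euclidean_space \<Rightarrow> real"
  assumes par: "0 < e" "0 < \<kappa>" "0 < t" and S: "8 * \<kappa>^3 * t\<^sup>2 / e < S"
    and sub: "viscosity_subsolution \<Omega> (\<lambda>_ _. S) v" and ball: "cball c r \<subseteq> \<Omega>" 
    and bd: "\<And>y. y \<in> sphere c r \<Longrightarrow> v y \<le> h + ramp c e \<kappa> t y"
    and x: "x \<in> cball c r"
  shows "v x \<le> h + ramp c e \<kappa> t x"
proof (rule ccontr)
  assume neg: "\<not> v x \<le> h + ramp c e \<kappa> t x"
  have "continuous_on \<Omega> v"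
    using sub unfolding viscosity_subsolution_def by blast
  then have "continuous_on (cball c r) v"
    by (rule continuous_on_subset[OF _ ball])
  then have "continuous_on (cball c r) (\<lambda>y. v y - ramp c e \<kappa> t y)"
    by (intro continuous_on_diff continuous_on_ramp)
  then obtain p where p: "p \<in> cball c r"
    "\<And>y. y \<in> cball c r \<Longrightarrow> v y - ramp c e \<kappa> t y \<le> v p - ramp c e \<kappa> t p"
    using continuous_attains_sup[OF compact_cball, of c r] x by blast
  have "dist c p \<noteq> r"
    using p(2)[OF x] neg bd[of p] by auto
  then have pb: "p \<in> ball c r"
    using p(1) by simp
  define T where "T = radial_quartic c ((p - c) \<bullet> (p - c)) (v p) (ramp_opening c e \<kappa> t p) 0"
  have "v y \<le> T y" if "y \<in> ball c r" for y
    using p(2)[of y] ramp_le_paraboloid[OF par, of c y p] that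
    by (simp add: T_def radial_quartic_def)
  then have "\<forall>\<^sub>F y in nhds p. v y \<le> T y"
    using eventually_nhds_in_open[OF open_ball pb] by (auto elim: eventually_mono)
  then have "S \<le> inf_laplacian T p"
    using p(1) ball
    by (intro viscosity_subsolutionD[OF sub]) (auto simp: T_def radial_quartic_def Ck_on_radial_quartic)
  also have "inf_laplacian T p = 8 * (ramp_opening c e \<kappa> t p)^3 * ((p - c) \<bullet> (p - c))"
    unfolding T_def by (subst inf_laplacian_radial_quartic[of "ramp_opening c e \<kappa> t p"])
      (auto simp: power2_eq_square power3_eq_cube)
  also have "\<dots> < S"
    using ramp_opening_laplacian[OF par, of c p] S by linarith
  finally show False by simp
qed

text \<open>On the cone the touching paraboloid only determines the gradient of \<open>\<phi>\<close>. The second-order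
  information comes from the cone itself, which is affine along the radial line, so that
  \<open>\<Delta>\<^sub>\<infinity>\<phi> \<le> 0\<close> there.\<close>

lemma ramp_supersolution:
  fixes \<phi> :: "'a::euclidean_space \<Rightarrow> real"
  assumes par: "0 < e" "0 < \<kappa>" "0 < t"
    and \<Omega>: "open \<Omega>" "Ck_on 2 \<Omega> \<phi>" "x \<in> \<Omega>"
    and touch: "\<phi> x = h + ramp c e \<kappa> t x" "\<forall>\<^sub>F y in nhds x. \<phi> y \<le> h + ramp c e \<kappa> t y"
    and g: "0 \<le> g" "norm (x - c) \<le> t * e \<Longrightarrow> 8 * \<kappa>^3 * t\<^sup>2 / e \<le> g"
  shows "inf_laplacian \<phi> x \<le> g"
proof -
  define \<beta> where "\<beta> = ramp_opening c e \<kappa> t x"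
  define v where "v = grad \<phi> x"
  have par_touch: "\<forall>\<^sub>F y in nhds x. \<phi> y \<le> \<phi> x + \<beta> * ((y - c) \<bullet> (y - c) - (x - c) \<bullet> (x - c))"
    using touch(2)
  proof eventually_elim
    case (elim y)
    then show ?case
      using ramp_le_paraboloid[OF par, of c y x] touch(1) by (simp add: \<beta>_def)
  qed
  have "\<phi> differentiable (at x)"
    using \<Omega>(2,3) by (simp add: numeral_2_eq_2)
  from grad_touching_paraboloid[OF this par_touch] have v: "v = (2 * \<beta>) *\<^sub>R (x - c)"
    by (simp add: v_def)
  have "((\<lambda>s. x + s *\<^sub>R v) \<longlongrightarrow> x + 0 *\<^sub>R v) (nhds 0)"
    by (intro tendsto_intros) (simp add: filterlim_ident)
  then have line: "filterlim (\<lambda>s. x + s *\<^sub>R v) (nhds x) (nhds 0)"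
    by simp
  show ?thesis
  proof (cases "norm (x - c) \<le> t * e")
    case True
    have "\<forall>\<^sub>F s in nhds 0. \<phi> (x + s *\<^sub>R v) \<le> \<phi> x + 4 * \<beta>\<^sup>2 * ((x - c) \<bullet> (x - c)) * s
        + 8 * \<beta>^3 * ((x - c) \<bullet> (x - c)) / 2 * s\<^sup>2"
      using eventually_compose_filterlim[OF par_touch line]
    proof eventually_elim
      case (elim s)
      define q where "q = (x - c) \<bullet> (x - c)"
      have "x + s *\<^sub>R v - c = (1 + 2 * \<beta> * s) *\<^sub>R (x - c)"
        by (simp add: v algebra_simps)
      then have "(x + s *\<^sub>R v - c) \<bullet> (x + s *\<^sub>R v - c) = (1 + 2 * \<beta> * s)\<^sup>2 * q"
        by (simp add: q_def power2_eq_square)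
      with elim have "\<phi> (x + s *\<^sub>R v) \<le> \<phi> x + \<beta> * ((1 + 2 * \<beta> * s)\<^sup>2 * q - q)"
        unfolding q_def by simp
      then show ?case
        unfolding q_def[symmetric] by (simp add: algebra_simps power2_eq_square power3_eq_cube)
    qed
    then have "inf_laplacian \<phi> x \<le> 8 * \<beta>^3 * ((x - c) \<bullet> (x - c))"
      unfolding v_def by (rule inf_laplacian_le_along_gradient[OF \<Omega>])
    then show ?thesis
      using ramp_opening_laplacian[OF par, of c x] g(2)[OF True] by (simp add: \<beta>_def)
  next
    case False
    define n where "n = norm (x - c)"
    have n: "0 < n"
      using False mult_pos_pos[OF par(3,1)] unfolding n_def by linarith
    have \<beta>: "2 * \<beta> * n = \<kappa> * t"
      using False n by (simp add: \<beta>_def ramp_opening_def n_def[symmetric])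
    have "((\<lambda>s::real. 1 + 2 * \<beta> * s) \<longlongrightarrow> 1 + 2 * \<beta> * 0) (nhds 0)"
      by (intro tendsto_intros) (simp add: filterlim_ident)
    then have pos: "\<forall>\<^sub>F s::real in nhds 0. 0 < 1 + 2 * \<beta> * s"
      by (rule order_tendstoD) simp
    have "\<forall>\<^sub>F s in nhds 0. \<phi> (x + s *\<^sub>R v) \<le> \<phi> x + (\<kappa> * t)\<^sup>2 * s + 0 / 2 * s\<^sup>2"
      using eventually_compose_filterlim[OF touch(2) line] pos
    proof eventually_elim
      case (elim s)
      have "x + s *\<^sub>R v - c = (1 + 2 * \<beta> * s) *\<^sub>R (x - c)"
        by (simp add: v algebra_simps)
      then have "norm (x + s *\<^sub>R v - c) = \<bar>1 + 2 * \<beta> * s\<bar> * n"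
        by (simp only: norm_scaleR n_def)
      also have "\<dots> = n + \<kappa> * t * s"
        using elim(2) by (simp add: \<beta>[symmetric] algebra_simps)
      finally have "norm (x + s *\<^sub>R v - c) = n + \<kappa> * t * s" .
      then have "ramp c e \<kappa> t (x + s *\<^sub>R v) \<le> \<kappa> * t * (n + \<kappa> * t * s)"
        by (simp add: ramp_def)
      moreover have "ramp c e \<kappa> t x = \<kappa> * t * n"
        unfolding n_def using False by (intro ramp_outer par) auto
      ultimately show ?case
        using elim(1) touch(1) by (simp add: algebra_simps power2_eq_square)
    qed
    then have "inf_laplacian \<phi> x \<le> 0"
      unfolding v_def by (rule inf_laplacian_le_along_gradient[OF \<Omega>])
    then show ?thesis
      using g(1) by simp
  qed
qed

section \<open>Operations on the Perron class\<close>

lemma viscosity_supersolution_min: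
  assumes v: "viscosity_supersolution \<Omega> f v" and w: "viscosity_supersolution \<Omega> f w"
  shows "viscosity_supersolution \<Omega> f (\<lambda>x. min (v x) (w x))"
  unfolding viscosity_supersolution_def
proof (intro conjI allI impI)
  show "continuous_on \<Omega> (\<lambda>x. min (v x) (w x))"
    using v w unfolding viscosity_supersolution_def by (auto intro: continuous_intros)
next
  fix \<phi> x
  assume *: "Ck_on 2 \<Omega> \<phi> \<and> x \<in> \<Omega> \<and>
    (\<forall>\<^sub>F y in nhds x. min (v x) (w x) - \<phi> x \<le> min (v y) (w y) - \<phi> y) \<and> \<phi> x = min (v x) (w x)"
  then have ev: "\<forall>\<^sub>F y in nhds x. \<phi> y \<le> v y" "\<forall>\<^sub>F y in nhds x. \<phi> y \<le> w y"
    by (auto elim!: eventually_mono)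
  have C: "Ck_on 2 \<Omega> \<phi>" "x \<in> \<Omega>"
    using * by blast+
  consider "\<phi> x = v x" | "\<phi> x = w x"
    using * by (auto simp: min_def split: if_splits)
  then show "inf_laplacian \<phi> x \<le> f x (\<phi> x)"
  proof cases
    case 1
    then show ?thesis using viscosity_supersolutionD[OF v C 1 ev(1)] by simp
  next
    case 2
    then show ?thesis using viscosity_supersolutionD[OF w C 2 ev(2)] by simp
  qed
qed

text \<open>The closed ball is used so that both pieces of the function live on closed sets; if \<open>w \<le> \<theta>\<close> on the
  sphere, the pieces agree there.\<close>

definition min_on_cball ::
  "'a::euclidean_space \<Rightarrow> real \<Rightarrow> ('a \<Rightarrow> real) \<Rightarrow> ('a \<Rightarrow> real) \<Rightarrow> 'a \<Rightarrow> real" where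
  "min_on_cball c r \<theta> w x = (if dist c x \<le> r then min (w x) (\<theta> x) else w x)"

lemma continuous_on_min_on_cball:
  assumes "continuous_on S w" "continuous_on S \<theta>" "\<And>y. y \<in> sphere c r \<Longrightarrow> w y \<le> \<theta> y"
  shows "continuous_on S (min_on_cball c r \<theta> w)"
  unfolding min_on_cball_def
  using assms(3)
  by (intro continuous_on_cases_le continuous_intros continuous_on_subset[OF assms(1)]
      continuous_on_subset[OF assms(2)]) (auto simp: min_def)

text \<open>Where the value is \<open>w x\<close>, a lower test function also touches \<open>w\<close>, because the new function is
  at most \<open>w\<close>. Elsewhere \<open>x\<close> lies in the open ball, since \<open>w \<le> \<theta>\<close> on the sphere, and the test
  function touches \<open>\<theta>\<close>.\<close>

lemma viscosity_supersolution_min_on_cball: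
  assumes w: "viscosity_supersolution \<Omega> f w" and \<theta>: "continuous_on \<Omega> \<theta>"
    and sphere: "\<And>y. y \<in> sphere c r \<Longrightarrow> w y \<le> \<theta> y"
    and super: "\<And>\<phi> x. Ck_on 2 \<Omega> \<phi> \<Longrightarrow> x \<in> \<Omega> \<Longrightarrow> x \<in> ball c r \<Longrightarrow> \<phi> x = \<theta> x \<Longrightarrow>
      \<forall>\<^sub>F y in nhds x. \<phi> y \<le> \<theta> y \<Longrightarrow> inf_laplacian \<phi> x \<le> f x (\<theta> x)"
  shows "viscosity_supersolution \<Omega> f (min_on_cball c r \<theta> w)"
  unfolding viscosity_supersolution_def
proof (intro conjI allI impI)
  let ?g = "min_on_cball c r \<theta> w"
  show "continuous_on \<Omega> ?g"
    using w \<theta> sphere unfolding viscosity_supersolution_def by (blast intro: continuous_on_min_on_cball)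
  fix \<phi> x
  assume *: "Ck_on 2 \<Omega> \<phi> \<and> x \<in> \<Omega> \<and> (\<forall>\<^sub>F y in nhds x. ?g x - \<phi> x \<le> ?g y - \<phi> y) \<and> \<phi> x = ?g x"
  then have C: "Ck_on 2 \<Omega> \<phi>" "x \<in> \<Omega>" and eq: "\<phi> x = ?g x"
    by blast+
  have ev: "\<forall>\<^sub>F y in nhds x. \<phi> y \<le> ?g y"
    using * by (auto elim!: eventually_mono)
  show "inf_laplacian \<phi> x \<le> f x (\<phi> x)"
  proof (cases "?g x = w x")
    case True
    have "\<forall>\<^sub>F y in nhds x. \<phi> y \<le> w y"
      using ev by eventually_elim (auto simp: min_on_cball_def split: if_splits)
    then show ?thesis
      using viscosity_supersolutionD[OF w C] eq True by simp
  next
    case False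
    then have g: "?g x = \<theta> x" "x \<in> ball c r"
      using sphere[of x] by (force simp: min_on_cball_def min_def split: if_splits)+
    have "\<forall>\<^sub>F y in nhds x. \<phi> y \<le> \<theta> y"
      using ev eventually_nhds_in_open[OF open_ball g(2)]
      by eventually_elim (auto simp: min_on_cball_def)
    then show ?thesis
      using super[OF C g(2)] eq g(1) by simp
  qed
qed

text \<open>Lets one member of the Perron class replace the infimum: the infimum lies below the barrier at
  every point of the sphere, but possibly through different members at different points. By
  compactness finitely many of them suffice, and their minimum is again a member.\<close>

lemma compact_pointwise_below_imp_member_below:
  fixes F :: "('a::topological_space \<Rightarrow> real) set"
  assumes "compact K" "F \<noteq> {}"
    and min: "\<And>v w. v \<in> F \<Longrightarrow> w \<in> F \<Longrightarrow> (\<lambda>x. min (v x) (w x)) \<in> F"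
    and cont: "\<And>w. w \<in> F \<Longrightarrow> continuous_on K w" "continuous_on K \<theta>"
    and below: "\<And>y. y \<in> K \<Longrightarrow> \<exists>w\<in>F. w y < \<theta> y"
  shows "\<exists>w\<in>F. \<forall>y\<in>K. w y < \<theta> y"
proof -
  define \<C> where "\<C> = {U. open U \<and> (\<exists>w\<in>F. \<forall>x\<in>K \<inter> U. w x < \<theta> x)}"
  have "K \<subseteq> \<Union>\<C>"
  proof
    fix y assume y: "y \<in> K"
    then obtain w where w: "w \<in> F" "w y < \<theta> y"
      using below by blast
    have "continuous_on K (\<lambda>x. \<theta> x - w x)"
      using cont w(1) by (intro continuous_on_diff) auto
    then obtain U where "open U" "y \<in> U" "\<forall>x\<in>K. x \<in> U \<longrightarrow> \<theta> x - w x \<in> {0<..}"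
      unfolding continuous_on_topological using y w(2)
      by (metis diff_gt_0_iff_gt greaterThan_iff open_greaterThan)
    then have "U \<in> \<C>"
      using w(1) by (auto simp: \<C>_def)
    then show "y \<in> \<Union>\<C>"
      using \<open>y \<in> U\<close> by blast
  qed
  moreover have "\<forall>U\<in>\<C>. open U"
    by (simp add: \<C>_def)
  ultimately obtain T where T: "T \<subseteq> \<C>" "finite T" "K \<subseteq> \<Union>T"
    using compactE[OF assms(1), of \<C>] by metis
  have "\<exists>w\<in>F. \<forall>x\<in>K \<inter> \<Union>T. w x < \<theta> x"
    using T(2,1)
  proof (induction T)
    case empty
    then show ?case using assms(2) by auto
  next
    case (insert U T)
    obtain w where w: "w \<in> F" "\<forall>x\<in>K \<inter> \<Union>T. w x < \<theta> x"
      using insert by auto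
    obtain v where v: "v \<in> F" "\<forall>x\<in>K \<inter> U. v x < \<theta> x"
      using insert.prems by (auto simp: \<C>_def)
    have "\<forall>x\<in>K \<inter> \<Union>(insert U T). min (v x) (w x) < \<theta> x"
      using v(2) w(2) by (auto simp: min_less_iff_disj)
    then show ?case
      using min[OF v(1) w(1)] by (rule bexI)
  qed
  then show ?thesis
    using T(3) by blast
qed

lemma perron_classD:
  assumes "w \<in> perron_class \<Omega> \<zeta> \<phi> u_lo u_hi"
  shows "continuous_on (closure \<Omega>) w" "viscosity_supersolution \<Omega> \<zeta> w"
    and "x \<in> frontier \<Omega> \<Longrightarrow> w x = \<phi> x"
    and "x \<in> \<Omega> \<Longrightarrow> 0 \<le> w x" "x \<in> \<Omega> \<Longrightarrow> u_lo x \<le> w x" "x \<in> \<Omega> \<Longrightarrow> w x \<le> u_hi x"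
  using assms by (simp_all add: perron_class_def has_boundary_values_def)

lemma perron_class_min:
  assumes v: "v \<in> perron_class \<Omega> \<zeta> \<phi> u_lo u_hi" and w: "w \<in> perron_class \<Omega> \<zeta> \<phi> u_lo u_hi"
  shows "(\<lambda>x. min (v x) (w x)) \<in> perron_class \<Omega> \<zeta> \<phi> u_lo u_hi"
  using perron_classD[OF v] perron_classD[OF w]
    viscosity_supersolution_min[OF perron_classD(2)[OF v] perron_classD(2)[OF w]]
  by (auto simp: perron_class_def has_boundary_values_def min_le_iff_disj intro: continuous_on_min)

lemma perron_envelope_le:
  assumes "\<forall>x\<in>closure \<Omega>. u x = (INF w\<in>perron_class \<Omega> \<zeta> \<phi> u_lo u_hi. w x)"
    and "w \<in> perron_class \<Omega> \<zeta> \<phi> u_lo u_hi" "x \<in> \<Omega>"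
  shows "u x \<le> w x"
proof -
  have "bdd_below ((\<lambda>w. w x) ` perron_class \<Omega> \<zeta> \<phi> u_lo u_hi)"
    using perron_classD(4) assms(3) by (intro bdd_belowI2[of _ 0]) blast
  then have "(INF w\<in>perron_class \<Omega> \<zeta> \<phi> u_lo u_hi. w x) \<le> w x"
    using assms(2) by (rule cINF_lower)
  then show ?thesis
    using assms(1,3) subsetD[OF closure_subset, of x \<Omega>] by simp
qed

lemma perron_envelope_nonneg:
  assumes "\<forall>x\<in>closure \<Omega>. u x = (INF w\<in>perron_class \<Omega> \<zeta> \<phi> u_lo u_hi. w x)"
    and "perron_class \<Omega> \<zeta> \<phi> u_lo u_hi \<noteq> {}" "x \<in> \<Omega>"
  shows "0 \<le> u x"
proof -
  have "0 \<le> (INF w\<in>perron_class \<Omega> \<zeta> \<phi> u_lo u_hi. w x)"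
    using assms(2,3) by (intro cINF_greatest) (auto dest: perron_classD(4))
  then show ?thesis
    using assms(1,3) subsetD[OF closure_subset, of x \<Omega>] by simp
qed

lemma perron_envelope_approx:
  assumes "\<forall>x\<in>closure \<Omega>. u x = (INF w\<in>perron_class \<Omega> \<zeta> \<phi> u_lo u_hi. w x)"
    and "perron_class \<Omega> \<zeta> \<phi> u_lo u_hi \<noteq> {}" "x \<in> \<Omega>" "u x < s"
  obtains w where "w \<in> perron_class \<Omega> \<zeta> \<phi> u_lo u_hi" "w x < s"
proof -
  have "u x = (INF w\<in>perron_class \<Omega> \<zeta> \<phi> u_lo u_hi. w x)"
    using assms(1,3) subsetD[OF closure_subset, of x \<Omega>] by blast
  moreover have "s \<le> (INF w\<in>perron_class \<Omega> \<zeta> \<phi> u_lo u_hi. w x)"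
    if "\<forall>w\<in>perron_class \<Omega> \<zeta> \<phi> u_lo u_hi. s \<le> w x"
    using assms(2) that by (intro cINF_greatest) auto
  ultimately show thesis
    using that assms(4) by (metis not_le)
qed

text \<open>Nondegeneracy from minimality. If the Perron solution were below the ramp on the whole sphere, some
  member \<open>w\<close> of the class would be below it too. Cutting \<open>w\<close> off by the ramp inside the ball gives a
  member of the class: the ramp is a supersolution by the lower bound on the reaction at the levels
  \<open>[h, h + \<kappa> t\<^sup>2 e]\<close>, and it stays above \<open>u_lo\<close> because \<open>S\<close> is larger than its infinity Laplacian. But at
  the centre this member equals at most \<open>h\<close>, which is less than \<open>u c\<close>.\<close>

lemma perron_sphere_above_ramp:
  fixes \<Omega> :: "'a::euclidean_space set"
  assumes \<Omega>: "open \<Omega>" and par: "0 < e" "0 < \<kappa>" "0 < t" "0 \<le> h"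
    and P: "perron_class \<Omega> \<zeta> \<phi> u_lo u_hi \<noteq> {}"
    and inf: "\<forall>x\<in>closure \<Omega>. u x = (INF w\<in>perron_class \<Omega> \<zeta> \<phi> u_lo u_hi. w x)"
    and u_lo: "viscosity_subsolution \<Omega> (\<lambda>_ _. S) u_lo" "8 * \<kappa>^3 * t\<^sup>2 / e < S"
    and \<zeta>: "\<And>x s. x \<in> \<Omega> \<Longrightarrow> 0 \<le> s \<Longrightarrow> 0 \<le> \<zeta> x s"
      "\<And>x s. x \<in> \<Omega> \<Longrightarrow> h \<le> s \<Longrightarrow> s \<le> h + \<kappa> * t\<^sup>2 * e \<Longrightarrow> 8 * \<kappa>^3 * t\<^sup>2 / e \<le> \<zeta> x s"
    and ball: "cball c r \<subseteq> \<Omega>" "0 < r" and c: "h < u c"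
  shows "\<exists>y\<in>sphere c r. h + ramp c e \<kappa> t y \<le> u y"
proof (rule ccontr)
  let ?P = "perron_class \<Omega> \<zeta> \<phi> u_lo u_hi"
  let ?\<theta> = "\<lambda>y. h + ramp c e \<kappa> t y"
  assume neg: "\<not> (\<exists>y\<in>sphere c r. ?\<theta> y \<le> u y)"
  have sub: "sphere c r \<subseteq> \<Omega>"
    using ball(1) sphere_cball by blast
  have "\<exists>w\<in>?P. \<forall>y\<in>sphere c r. w y < ?\<theta> y"
  proof (rule compact_pointwise_below_imp_member_below)
    fix y assume y: "y \<in> sphere c r"
    then have "u y < ?\<theta> y" "y \<in> \<Omega>"
      using neg sub by (auto simp: not_le)
    then show "\<exists>w\<in>?P. w y < ?\<theta> y"
      using perron_envelope_approx[OF inf P] by blast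
  next
    fix w assume "w \<in> ?P"
    then show "continuous_on (sphere c r) w"
      by (rule continuous_on_subset[OF perron_classD(1) subset_trans[OF sub closure_subset]])
  next
    show "(\<lambda>x. min (v x) (w x)) \<in> ?P" if "v \<in> ?P" "w \<in> ?P" for v w
      using that by (rule perron_class_min)
  next
    show "continuous_on (sphere c r) ?\<theta>"
      by (intro continuous_intros)
  qed (use P in auto)
  then obtain w where w: "w \<in> ?P" "\<And>y. y \<in> sphere c r \<Longrightarrow> w y < ?\<theta> y"
    by blast
  define g where "g = min_on_cball c r ?\<theta> w"
  have \<theta>_cont: "continuous_on T ?\<theta>" for T
    by (intro continuous_intros)
  have nonneg: "0 \<le> ?\<theta> y" for y
    using ramp_nonneg[OF par(1-3), of c y] par(4) by simp
  have "g \<in> ?P"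
    unfolding perron_class_def mem_Collect_eq has_boundary_values_def
  proof (intro conjI ballI)
    show "continuous_on (closure \<Omega>) g"
      unfolding g_def using perron_classD(1)[OF w(1)] w(2)
      by (intro continuous_on_min_on_cball \<theta>_cont) (auto simp: less_imp_le)
    show "g x = \<phi> x" if "x \<in> frontier \<Omega>" for x
    proof -
      have "x \<notin> \<Omega>"
        using that \<Omega> by (simp add: frontier_def interior_open)
      then show ?thesis
        using ball(1) perron_classD(3)[OF w(1) that] by (auto simp: g_def min_on_cball_def)
    qed
    show "viscosity_supersolution \<Omega> \<zeta> g"
      unfolding g_def
    proof (rule viscosity_supersolution_min_on_cball[OF perron_classD(2)[OF w(1)] \<theta>_cont])
      show "w y \<le> ?\<theta> y" if "y \<in> sphere c r" for y
        using w(2)[OF that] by simp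
      fix \<psi> x
      assume \<psi>: "Ck_on 2 \<Omega> \<psi>" "x \<in> \<Omega>" "\<psi> x = ?\<theta> x" "\<forall>\<^sub>F y in nhds x. \<psi> y \<le> ?\<theta> y"
      show "inf_laplacian \<psi> x \<le> \<zeta> x (?\<theta> x)"
      proof (rule ramp_supersolution[OF par(1-3) \<Omega> \<psi>])
        show "0 \<le> \<zeta> x (?\<theta> x)"
          using \<zeta>(1) \<psi>(2) nonneg by blast
        assume n: "norm (x - c) \<le> t * e"
        have "\<kappa> / e * (norm (x - c))\<^sup>2 \<le> \<kappa> / e * (t * e)\<^sup>2"
          using n par by (intro mult_left_mono power_mono) auto
        also have "\<dots> = \<kappa> * t\<^sup>2 * e"
          using par by (simp add: power2_eq_square)
        finally have "ramp c e \<kappa> t x \<le> \<kappa> * t\<^sup>2 * e"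
          unfolding ramp_inner[OF par(1-3) n] by (simp add: dot_square_norm)
        then show "8 * \<kappa>^3 * t\<^sup>2 / e \<le> \<zeta> x (?\<theta> x)"
          using ramp_nonneg[OF par(1-3), of c x] by (intro \<zeta>(2)[OF \<psi>(2)]) auto
      qed
    qed
    fix x assume x: "x \<in> \<Omega>"
    show "0 \<le> g x"
      using perron_classD(4)[OF w(1) x] nonneg[of x] by (simp add: g_def min_on_cball_def)
    have "u_lo x \<le> ?\<theta> x" if "x \<in> cball c r"
    proof (rule subsolution_le_ramp[OF par(1-3) u_lo(2,1) ball(1) _ that])
      fix y assume "y \<in> sphere c r"
      then show "u_lo y \<le> ?\<theta> y"
        using w(2)[of y] perron_classD(5)[OF w(1), of y] sub by force
    qed
    then show "u_lo x \<le> g x"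
      using perron_classD(5)[OF w(1) x] by (auto simp: g_def min_on_cball_def)
    show "g x \<le> u_hi x"
      using perron_classD(6)[OF w(1) x] by (auto simp: g_def min_on_cball_def)
  qed
  moreover have "c \<in> \<Omega>"
    using ball by auto
  ultimately have "u c \<le> g c"
    using perron_envelope_le[OF inf] by blast
  also have "g c \<le> h"
    using ball(2) by (simp add: g_def min_on_cball_def)
  finally show False
    using c by simp
qed

section \<open>Comparison with the distance to the low-value zone\<close>

text \<open>Growth is propagated in two stages. From \<open>x\<close>, in the ball of radius \<open>d\<close> where \<open>w > e\<close> and the
  reaction is at most \<open>C\<close>, a large value \<open>w x / d\<close> forces \<open>w\<close> to be at least a multiple of
  \<open>e w x / d\<close> at a point \<open>z\<close> at distance \<open>e/2\<close> from the sphere. From \<open>z\<close>, in the ball of radius \<open>e\<close>, the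
  reaction may be as large as \<open>B/e + C\<close>, but this times the radius is bounded, so \<open>w\<close> is also a
  large multiple of \<open>e\<close> at the nearby point \<open>y\<close>, against \<open>w y \<le> 2 e\<close>.\<close>

lemma supersolution_le_distance:
  fixes w :: "'a::euclidean_space \<Rightarrow> real"
  assumes super: "viscosity_supersolution \<Omega> \<zeta> w" and nonneg: "\<And>y. y \<in> \<Omega> \<Longrightarrow> 0 \<le> w y"
    and ball: "cball x (2 * d) \<subseteq> \<Omega>" and e: "0 < e" "e \<le> d" "d \<le> \<delta>"
    and BC: "0 \<le> B" "0 \<le> C"
    and \<zeta>: "\<And>y s. y \<in> \<Omega> \<Longrightarrow> 0 \<le> s \<Longrightarrow> \<zeta> y s \<le> B / e * indicat_real {0<..<e} s + C"
    and above: "\<And>y. y \<in> ball x d \<Longrightarrow> e < w y"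
    and y: "d \<le> dist x y" "dist x y \<le> d + e / 4" "w y \<le> 2 * e"
  shows "w x \<le> (64 + 128 * (B + C * \<delta>)) * d"
proof (rule ccontr)
  define L where "L = 16 + 32 * (B + C * \<delta>)"
  assume "\<not> w x \<le> (64 + 128 * (B + C * \<delta>)) * d"
  then have big: "4 * L * d < w x"
    by (simp add: L_def algebra_simps)
  have d: "0 < d"
    using e by linarith
  have C\<delta>: "C * e \<le> C * \<delta>" "C * d \<le> C * \<delta>" "0 \<le> C * \<delta>"
    using e d BC by (auto intro: mult_left_mono)
  have L: "16 \<le> L" "32 * (C * d) \<le> 4 * L" "32 * ((B / e + C) * e) \<le> L"
    using C\<delta> BC e(1) by (auto simp: L_def algebra_simps)
  have wx: "0 \<le> w x"
    using ball d by (intro nonneg) auto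
  define z where "z = x + ((d - e / 2) / dist x y) *\<^sub>R (y - x)"
  have D: "0 < dist x y"
    using y(1) d by linarith
  have xz: "dist x z = d - e / 2"
    using D e by (simp add: z_def dist_norm norm_minus_commute)
  have zy: "dist z y \<le> 3 / 4 * e"
  proof -
    have "z - y = (1 - (d - e / 2) / dist x y) *\<^sub>R (x - y)"
      by (simp add: z_def algebra_simps)
    moreover have "0 \<le> 1 - (d - e / 2) / dist x y"
      using D y(1) e(1) by simp
    ultimately have "dist z y = (1 - (d - e / 2) / dist x y) * dist x y"
      by (simp add: dist_norm)
    also have "\<dots> = dist x y - (d - e / 2)"
      using D by (simp add: field_simps)
    finally show ?thesis
      using y(2) by simp
  qed
  have "w x * (1 - sqrt (dist x z / d)) \<le> w z"
  proof (rule supersolution_growth_at_linear_height[OF super _ d, of x C "4 * L"])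
    have "cball x d \<subseteq> cball x (2 * d)"
      using d by (intro subset_cball) simp
    then show "cball x d \<subseteq> \<Omega>"
      using ball by (rule subset_trans)
    then show "0 \<le> w v" if "v \<in> cball x d" for v
      using nonneg[of v] that by blast
    show "\<zeta> v (w v) \<le> C" if "v \<in> ball x d" for v
    proof -
      have "v \<in> \<Omega>"
        using that \<open>cball x d \<subseteq> \<Omega>\<close> ball_subset_cball by blast
      then show ?thesis
        using \<zeta>[of v "w v"] above[OF that] e(1) by simp
    qed
    show "z \<in> cball x d"
      using xz e by simp
  qed (use L big in auto)
  moreover have "sqrt (dist x z / d) \<le> 1 - e / (4 * d)"
  proof (rule real_le_lsqrt)
    have "(1 - e / (4 * d))\<^sup>2 = 1 - e / (2 * d) + (e / (4 * d))\<^sup>2"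
      by (simp add: power2_diff)
    moreover have "dist x z / d = 1 - e / (2 * d)"
      using d by (simp add: xz field_simps)
    ultimately show "dist x z / d \<le> (1 - e / (4 * d))\<^sup>2"
      by simp
    show "0 \<le> 1 - e / (4 * d)"
      using e d by simp
  qed
  ultimately have "w x * (e / (4 * d)) \<le> w z"
    using mult_left_mono[of "e / (4 * d)" "1 - sqrt (dist x z / d)" "w x"] wx by linarith
  moreover have "4 * L * d * (e / (4 * d)) < w x * (e / (4 * d))"
    using big e d by (intro mult_strict_right_mono) auto
  ultimately have wz: "L * e < w z"
    using d by simp
  have "cball z e \<subseteq> cball x (2 * d)"
    using xz e(1,2) by (simp add: cball_subset_cball_iff dist_commute)
  then have zball: "cball z e \<subseteq> \<Omega>"
    using ball by blast
  have "w z * (1 - sqrt (dist z y / e)) \<le> w y"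
  proof (rule supersolution_growth_at_linear_height[OF super zball e(1), of "B / e + C" L])
    show "0 \<le> w v" if "v \<in> cball z e" for v
      using nonneg[of v] that zball by blast
    show "\<zeta> v (w v) \<le> B / e + C" if "v \<in> ball z e" for v
    proof -
      have "v \<in> \<Omega>"
        using that zball by auto
      moreover have "B / e * indicat_real {0<..<e} (w v) \<le> B / e"
        using BC(1) e(1) by (simp add: indicator_def)
      ultimately show ?thesis
        using \<zeta>[OF _ nonneg, of v] by force
    qed
    show "y \<in> cball z e"
      using zy e(1) by simp
  qed (use L wz in auto)
  moreover have "sqrt (dist z y / e) \<le> 7 / 8"
    using zy e(1) by (intro real_le_lsqrt) (auto simp: field_simps power2_eq_square)
  moreover have "0 \<le> w z"
    using zball e(1) by (intro nonneg) auto
  ultimately have "w z * (1 / 8) \<le> w y"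
    using mult_left_mono[of "1 / 8" "1 - sqrt (dist z y / e)" "w z"] by linarith
  moreover have "16 * e \<le> L * e"
    using L(1) e(1) by simp
  ultimately show False
    using wz y(3) by simp
qed

text \<open>A member of the class that is small at a point almost nearest to \<open>x\<close> dominates \<open>u\<close>, hence also
  exceeds \<open>e\<close> within distance \<open>d\<close> of \<open>x\<close>, and \<open>supersolution_le_distance\<close> applies to it. When \<open>d\<close> is too
  large for the ball of radius \<open>2 d\<close> to fit into \<open>\<Omega>\<close>, the bound \<open>u \<le> A\<close> is already linear in \<open>d\<close>.\<close>

lemma perron_upper_bound:
  fixes \<Omega> :: "'a::euclidean_space set"
  assumes P: "perron_class \<Omega> \<zeta> \<phi> u_lo u_hi \<noteq> {}"
    and inf: "\<forall>x\<in>closure \<Omega>. u x = (INF w\<in>perron_class \<Omega> \<zeta> \<phi> u_lo u_hi. w x)"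
    and u_hi: "\<And>x. x \<in> \<Omega> \<Longrightarrow> u_hi x \<le> A"
    and \<zeta>: "\<And>y s. y \<in> \<Omega> \<Longrightarrow> 0 \<le> s \<Longrightarrow> \<zeta> y s \<le> B / e * indicat_real {0<..<e} s + C"
    and BC: "0 \<le> A" "0 \<le> B" "0 \<le> C"
    and \<delta>: "0 < \<delta>" "cball x \<delta> \<subseteq> \<Omega>"
    and e: "0 < e" "e \<le> d"
    and Z: "Z = {x \<in> \<Omega>. 0 \<le> u x \<and> u x \<le> e}" "Z \<noteq> {}" "d = infdist x Z"
    and above: "\<And>y. y \<in> \<Omega> \<Longrightarrow> dist x y < d \<Longrightarrow> e < u y"
  shows "u x \<le> (64 + 128 * (B + C * \<delta>) + 2 * A / \<delta>) * d"
proof (cases "d \<le> \<delta> / 2")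
  case True
  have "infdist x Z < d + e / 4"
    using Z(3) e by simp
  then obtain y where y: "y \<in> Z" "dist x y < d + e / 4"
    unfolding infdist_notempty[OF Z(2)] by (subst (asm) cINF_less_iff) (use Z(2) in auto)
  have ball: "cball x (2 * d) \<subseteq> \<Omega>"
    using \<delta>(2) True subset_cball[of "2 * d" \<delta> x] by auto
  have x: "x \<in> \<Omega>"
    using \<delta> by auto
  have "y \<in> \<Omega>" "u y < 2 * e"
    using y(1) Z(1) e(1) by auto
  then obtain w where w: "w \<in> perron_class \<Omega> \<zeta> \<phi> u_lo u_hi" "w y < 2 * e"
    using perron_envelope_approx[OF inf P] by blast
  have "w x \<le> (64 + 128 * (B + C * \<delta>)) * d"
  proof (rule supersolution_le_distance[OF perron_classD(2,4)[OF w(1)] ball e _ BC(2,3) \<zeta>])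
    show "e < w v" if "v \<in> ball x d" for v
    proof -
      have "v \<in> \<Omega>"
        using that ball e by auto
      then show ?thesis
        using above[of v] perron_envelope_le[OF inf w(1), of v] that by simp
    qed
    show "d \<le> dist x y"
      using infdist_le[OF y(1)] Z(3) by simp
  qed (use True \<delta>(1) y(2) w(2) in auto)
  moreover have "u x \<le> w x"
    by (rule perron_envelope_le[OF inf w(1) x])
  moreover have "0 \<le> 2 * A / \<delta> * d"
    using BC(1) \<delta>(1) e by simp
  ultimately show ?thesis
    by (simp add: algebra_simps)
next
  case False
  have x: "x \<in> \<Omega>"
    using \<delta> by auto
  obtain w where w: "w \<in> perron_class \<Omega> \<zeta> \<phi> u_lo u_hi"
    using P by blast
  have "u x \<le> A"
    using perron_envelope_le[OF inf w x] perron_classD(6)[OF w x] u_hi[OF x] by linarith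
  also have "A \<le> 2 * A / \<delta> * d"
  proof -
    have "2 * A / \<delta> * (\<delta> / 2) \<le> 2 * A / \<delta> * d"
      using False BC(1) \<delta>(1) by (intro mult_left_mono) auto
    then show ?thesis
      using \<delta>(1) by simp
  qed
  also have "\<dots> \<le> (64 + 128 * (B + C * \<delta>) + 2 * A / \<delta>) * d"
    using BC \<delta>(1) e by (intro mult_right_mono) auto
  finally show ?thesis .
qed

text \<open>\<open>perron_sphere_above_ramp\<close> only provides some point \<open>y\<close> at distance \<open>r\<close> where \<open>u\<close> is of order \<open>r\<close>. The
  growth lemma, applied to a member of the class in the ball of radius \<open>2 r\<close> about \<open>y\<close>, carries this
  height back to \<open>x\<close>; in that ball the reaction is at most \<open>C\<close>, and \<open>r\<close> is so small that \<open>C r\<^sup>4\<close> does not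
  compete with \<open>(\<kappa> r)\<^sup>3\<close>.\<close>

lemma perron_lower_bound_radius:
  fixes \<Omega> :: "'a::euclidean_space set"
  assumes \<Omega>: "open \<Omega>" and par: "0 < e" "0 < \<kappa>" "1 \<le> t" "0 \<le> h" "h < e"
    and P: "perron_class \<Omega> \<zeta> \<phi> u_lo u_hi \<noteq> {}"
    and inf: "\<forall>x\<in>closure \<Omega>. u x = (INF w\<in>perron_class \<Omega> \<zeta> \<phi> u_lo u_hi. w x)"
    and u_lo: "viscosity_subsolution \<Omega> (\<lambda>_ _. S) u_lo" "8 * \<kappa>^3 * t\<^sup>2 / e < S"
    and \<zeta>: "\<And>x s. x \<in> \<Omega> \<Longrightarrow> 0 \<le> s \<Longrightarrow> 0 \<le> \<zeta> x s"
      "\<And>x s. x \<in> \<Omega> \<Longrightarrow> h \<le> s \<Longrightarrow> s \<le> h + \<kappa> * t\<^sup>2 * e \<Longrightarrow> 8 * \<kappa>^3 * t\<^sup>2 / e \<le> \<zeta> x s"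
      "\<And>x s. x \<in> \<Omega> \<Longrightarrow> e < s \<Longrightarrow> \<zeta> x s \<le> C"
    and r: "0 < r" "cball x (3 * r) \<subseteq> \<Omega>" "e \<le> 4 * r" "512 * C * r < (\<kappa> / 4)^3"
    and above: "\<And>y. y \<in> ball x (3 * r) \<Longrightarrow> e < u y"
  shows "\<kappa> / 16 * r \<le> u x"
proof (rule ccontr)
  assume "\<not> \<kappa> / 16 * r \<le> u x"
  have x: "x \<in> \<Omega>" "e < u x"
    using r(1,2) above[of x] by auto
  have t: "0 < t"
    using par(3) by simp
  have "cball x r \<subseteq> cball x (3 * r)"
    using r(1) by (intro subset_cball) simp
  then have ball: "cball x r \<subseteq> \<Omega>"
    using r(2) by (rule subset_trans)
  have "h < u x"
    using x(2) par(5) by simp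
  obtain y where y: "y \<in> sphere x r" "h + ramp x e \<kappa> t y \<le> u y"
    using perron_sphere_above_ramp[OF \<Omega> par(1,2) t par(4) P inf u_lo \<zeta>(1,2) ball r(1) \<open>h < u x\<close>]
    by blast
  have "\<kappa> / 4 * r \<le> ramp x e \<kappa> t y"
  proof -
    have n: "norm (y - x) = r"
      using y(1) by (simp add: dist_norm norm_minus_commute)
    have "\<kappa> / 4 * r \<le> \<kappa> / e * r\<^sup>2"
    proof -
      have "\<kappa> / e * (e / 4 * r) \<le> \<kappa> / e * (r * r)"
        using r(1,3) par(1,2) by (intro mult_left_mono mult_right_mono) auto
      then show ?thesis
        using par(1) by (simp add: power2_eq_square)
    qed
    moreover have "\<kappa> * r * (1 / 4) \<le> \<kappa> * r * t"
      using r(1) par(2,3) by (intro mult_left_mono) auto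
    ultimately show ?thesis
      by (simp add: ramp_def dot_square_norm n mult_ac)
  qed
  then have uy: "\<kappa> / 4 * r \<le> u y"
    using y(2) par(4) by linarith
  obtain w where w: "w \<in> perron_class \<Omega> \<zeta> \<phi> u_lo u_hi" "w x < \<kappa> / 16 * r"
    using perron_envelope_approx[OF inf P x(1)] \<open>\<not> _ \<le> u x\<close> by (metis not_le)
  have yball: "cball y (2 * r) \<subseteq> cball x (3 * r)" "ball y (2 * r) \<subseteq> ball x (3 * r)"
    using y(1) r(1) by (auto simp: cball_subset_cball_iff ball_subset_ball_iff dist_commute)
  have "y \<in> \<Omega>"
    using y(1) ball sphere_cball by blast
  then have wy: "\<kappa> / 4 * r \<le> w y"
    using uy perron_envelope_le[OF inf w(1), of y] by linarith
  have "w y * (1 - sqrt (dist y x / (2 * r))) \<le> w x"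
  proof (rule supersolution_growth_from_centre[OF perron_classD(2)[OF w(1)], of y "2 * r" C])
    show sub: "cball y (2 * r) \<subseteq> \<Omega>"
      using yball(1) r(2) by (rule subset_trans)
    show "0 \<le> w v" if "v \<in> cball y (2 * r)" for v
      using perron_classD(4)[OF w(1)] that sub by blast
    show "\<zeta> v (w v) \<le> C" if "v \<in> ball y (2 * r)" for v
    proof -
      have v: "v \<in> \<Omega>" "v \<in> ball x (3 * r)"
        using that sub ball_subset_cball yball(2) by blast+
      then show ?thesis
        using \<zeta>(3)[OF v(1)] above[OF v(2)] perron_envelope_le[OF inf w(1) v(1)] by force
    qed
    have "32 * C * (2 * r)^4 = 512 * C * r * r^3"
      by (simp add: power_eq_if)
    also have "\<dots> < (\<kappa> / 4)^3 * r^3"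
      using r(1,4) by (intro mult_strict_right_mono) auto
    also have "\<dots> = (\<kappa> / 4 * r)^3"
      by (rule power_mult_distrib[symmetric])
    also have "\<dots> \<le> (w y)^3"
      using wy r(1) par(2) by (intro power_mono) auto
    finally show "32 * C * (2 * r)^4 < (w y)^3" .
  qed (use r(1) y(1) in \<open>auto simp: dist_commute\<close>)
  moreover have "sqrt (dist y x / (2 * r)) \<le> 3 / 4"
    using r(1) y(1) by (intro real_le_lsqrt) (auto simp: dist_commute power2_eq_square)
  moreover have "0 \<le> w y"
    by (rule perron_classD(4)[OF w(1) \<open>y \<in> \<Omega>\<close>])
  ultimately have "w y * (1 / 4) \<le> w x"
    using mult_left_mono[of "1 / 4" "1 - sqrt (dist y x / (2 * r))" "w y"] by linarith
  then show False
    using wy w(2) by simp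
qed

text \<open>If \<open>e \<ge> \<rho>\<close>, then \<open>u x > e \<ge> \<rho>\<close> is comparable to \<open>d \<le> D\<close> at once. If \<open>e < \<rho>\<close>, the largest admissible
  radius \<open>min (d/4) \<rho>\<close> is comparable to \<open>d\<close>. In this case \<open>a < 1\<close>: above the level \<open>e\<close> the reaction is
  bounded by \<open>C\<close>, so it can be of size \<open>R/e\<close> there only for \<open>e\<close> not too small. This makes \<open>a e\<close>, the
  value of the barrier at the centre, smaller than \<open>e\<close>.\<close>

lemma perron_lower_bound:
  fixes \<Omega> :: "'a::euclidean_space set"
  assumes \<Omega>: "open \<Omega>" "x \<in> \<Omega>"
    and par: "0 < e" "0 < \<kappa>" "1 \<le> t" "8 * \<kappa>^3 * t\<^sup>2 < R" "0 \<le> a" "a + \<kappa> * t\<^sup>2 \<le> b" "0 \<le> C"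
    and P: "perron_class \<Omega> \<zeta> \<phi> u_lo u_hi \<noteq> {}"
    and inf: "\<forall>x\<in>closure \<Omega>. u x = (INF w\<in>perron_class \<Omega> \<zeta> \<phi> u_lo u_hi. w x)"
    and u_lo: "viscosity_subsolution \<Omega> (\<lambda>_ _. S) u_lo" "R / e \<le> S"
    and \<zeta>: "\<And>y s. y \<in> \<Omega> \<Longrightarrow> 0 \<le> s \<Longrightarrow> 0 \<le> \<zeta> y s"
      "\<And>y s. y \<in> \<Omega> \<Longrightarrow> a * e \<le> s \<Longrightarrow> s \<le> b * e \<Longrightarrow> R / e \<le> \<zeta> y s"
      "\<And>y s. y \<in> \<Omega> \<Longrightarrow> e \<le> s \<Longrightarrow> \<zeta> y s \<le> C"
    and \<rho>: "0 < \<rho>" "cball x (4 * \<rho>) \<subseteq> \<Omega>" "\<rho> * (C + 1) \<le> R" "512 * (C + 1) * \<rho> \<le> (\<kappa> / 4)^3"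
    and d: "e \<le> d" "d \<le> D"
    and above: "\<And>y. y \<in> \<Omega> \<Longrightarrow> dist x y < d \<Longrightarrow> e < u y"
  shows "min (\<rho> / D) (\<kappa> / 16 * min (1 / 4) (\<rho> / D)) * d \<le> u x"
proof (cases "\<rho> \<le> e")
  case True
  have "min (\<rho> / D) (\<kappa> / 16 * min (1 / 4) (\<rho> / D)) * d \<le> \<rho> / D * D"
    using d \<rho>(1) par(1) by (intro mult_mono) auto
  also have "\<dots> = \<rho>"
    using d par(1) by simp
  finally show ?thesis
    using above[OF \<Omega>(2)] True d(1) par(1) by simp
next
  case False
  have "a < 1"
  proof (rule ccontr)
    assume "\<not> a < 1"
    have "a \<le> b"
      using par(2,6) by (smt (verit) mult_nonneg_nonneg zero_le_power2)
    then have "R / e \<le> \<zeta> x (a * e)"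
      using par(1) by (intro \<zeta>(2)[OF \<Omega>(2)]) auto
    also have "\<dots> \<le> C"
      using \<open>\<not> a < 1\<close> par(1) by (intro \<zeta>(3)[OF \<Omega>(2)]) simp
    finally have "R \<le> C * e"
      using par(1) by (simp add: field_simps)
    also have "\<dots> \<le> C * \<rho>"
      using False par(7) by (intro mult_left_mono) auto
    also have "\<dots> < \<rho> * (C + 1)"
      using \<rho>(1) by (simp add: algebra_simps)
    finally show False
      using \<rho>(3) by simp
  qed
  have rate: "8 * \<kappa>^3 * t\<^sup>2 / e < R / e"
    using par(1,4) by (intro divide_strict_right_mono)
  define r where "r = min (d / 4) \<rho>"
  have r: "0 < r" "r \<le> \<rho>" "4 * r \<le> d" "e \<le> 4 * r"
    using d(1) par(1) \<rho>(1) False by (auto simp: r_def)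
  have "cball x (3 * r) \<subseteq> cball x (4 * \<rho>)"
    using r by (intro subset_cball) simp
  then have ball: "cball x (3 * r) \<subseteq> \<Omega>"
    using \<rho>(2) by (rule subset_trans)
  have "\<kappa> / 16 * r \<le> u x"
  proof (rule perron_lower_bound_radius[OF \<Omega>(1) par(1-3) _ _ P inf u_lo(1), of "a * e"])
    show "8 * \<kappa>^3 * t\<^sup>2 / e < S"
      using rate u_lo(2) by linarith
    show "8 * \<kappa>^3 * t\<^sup>2 / e \<le> \<zeta> y s"
      if "y \<in> \<Omega>" "a * e \<le> s" "s \<le> a * e + \<kappa> * t\<^sup>2 * e" for y s
    proof -
      have "(a + \<kappa> * t\<^sup>2) * e \<le> b * e"
        using par(1,6) by (intro mult_right_mono) auto
      then have "s \<le> b * e"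
        using that(3) by (simp add: algebra_simps)
      then show ?thesis
        using \<zeta>(2)[OF that(1,2)] rate by simp
    qed
    have "512 * C * r \<le> 512 * C * \<rho>"
      using r(2) par(7) by (intro mult_left_mono) auto
    also have "\<dots> < 512 * (C + 1) * \<rho>"
      using \<rho>(1) by (simp add: algebra_simps)
    finally show "512 * C * r < (\<kappa> / 4)^3"
      using \<rho>(4) by simp
    show "e < u y" if "y \<in> ball x (3 * r)" for y
      using that r ball ball_subset_cball by (intro above) auto
  qed (use \<open>a < 1\<close> par r ball \<zeta>(1,3) in auto)
  moreover have "min (1 / 4) (\<rho> / D) * d \<le> r"
  proof -
    have "min (1 / 4) (\<rho> / D) * d \<le> 1 / 4 * d"
      by (rule mult_right_mono[OF min.cobounded1]) (use d par(1) in linarith)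
    then have 1: "min (1 / 4) (\<rho> / D) * d \<le> d / 4"
      by linarith
    have "min (1 / 4) (\<rho> / D) * d \<le> \<rho> / D * D"
      using d \<rho>(1) par(1) by (intro mult_mono) auto
    also have "\<dots> = \<rho>"
      using d par(1) by simp
    finally show ?thesis
      unfolding r_def using 1 by (intro min.boundedI)
  qed
  then have "\<kappa> / 16 * (min (1 / 4) (\<rho> / D) * d) \<le> \<kappa> / 16 * r"
    using par(2) by (intro mult_left_mono) auto
  moreover have "min (\<rho> / D) (\<kappa> / 16 * min (1 / 4) (\<rho> / D)) * d \<le>
      \<kappa> / 16 * min (1 / 4) (\<rho> / D) * d"
    by (rule mult_right_mono[OF min.cobounded2]) (use d par(1) in linarith)
  ultimately show ?thesis
    by (simp add: mult.assoc)
qed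

text \<open>With \<open>\<kappa> t\<^sup>2 = \<beta>\<close> fixed, \<open>8 \<kappa>\<^sup>3 t\<^sup>2 = 8 \<beta>\<^sup>3 / t\<^sup>4\<close> becomes small for large \<open>t\<close>: climbing the same height over a
  longer distance costs less.\<close>

lemma barrier_parameters_exist:
  fixes a b R :: real
  assumes "a < b" "0 < R"
  obtains \<kappa> t where "0 < \<kappa>" "1 \<le> t" "8 * \<kappa>^3 * t\<^sup>2 < R" "a + \<kappa> * t\<^sup>2 \<le> b"
proof -
  define \<beta> where "\<beta> = min (b - a) 1"
  define t where "t = 1 + 8 / R"
  define \<kappa> where "\<kappa> = \<beta> / t\<^sup>2"
  have \<beta>: "0 < \<beta>" "\<beta> \<le> 1"
    using assms(1) by (auto simp: \<beta>_def)
  have t: "1 \<le> t" "8 / R < t"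
    using assms(2) by (auto simp: t_def)
  have "8 * \<kappa>^3 * t\<^sup>2 = 8 * \<beta>^3 / t^4"
    using t(1) by (simp add: \<kappa>_def power_eq_if)
  also have "\<dots> \<le> 8 * 1 / t^1"
    using t(1) \<beta> by (intro frac_le mult_left_mono power_le_one power_increasing) auto
  also have "\<dots> < R"
    using t assms(2) by (simp add: field_simps)
  finally have "8 * \<kappa>^3 * t\<^sup>2 < R" .
  moreover have "0 < \<kappa>" "a + \<kappa> * t\<^sup>2 \<le> b"
    using t(1) \<beta>(1) by (auto simp: \<kappa>_def \<beta>_def)
  ultimately show thesis
    using that t(1) by blast
qed

lemma admissible_reactionD:
  assumes adm: "admissible_reaction \<Omega> B C a b R \<epsilon> \<zeta>" and pos: "0 < \<epsilon>" "0 \<le> a" "0 \<le> B" "0 \<le> C"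
    and x: "x \<in> \<Omega>"
  shows "0 \<le> s \<Longrightarrow> 0 \<le> \<zeta> x s"
    and "0 \<le> s \<Longrightarrow> \<zeta> x s \<le> B / \<epsilon> * indicat_real {0<..<\<epsilon>} s + C"
    and "\<epsilon> \<le> s \<Longrightarrow> \<zeta> x s \<le> C"
    and "a * \<epsilon> \<le> s \<Longrightarrow> s \<le> b * \<epsilon> \<Longrightarrow> R / \<epsilon> \<le> \<zeta> x s"
    and "a * \<epsilon> \<le> s \<Longrightarrow> s \<le> b * \<epsilon> \<Longrightarrow> R / \<epsilon> \<le> (SUP (y, t)\<in>\<Omega> \<times> {0..}. \<zeta> y t)"
proof -
  have nonneg: "0 \<le> \<zeta> y s" if "0 \<le> s" "y \<in> \<Omega>" for y s
    using adm that by (simp add: admissible_reaction_def)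
  have upper: "\<zeta> y s \<le> B / \<epsilon> * indicat_real {0<..<\<epsilon>} s + C" if "0 \<le> s" "y \<in> \<Omega>" for y s
    using adm that by (simp add: admissible_reaction_def)
  show "0 \<le> s \<Longrightarrow> 0 \<le> \<zeta> x s" "0 \<le> s \<Longrightarrow> \<zeta> x s \<le> B / \<epsilon> * indicat_real {0<..<\<epsilon>} s + C"
    using nonneg upper x by blast+
  show "\<zeta> x s \<le> C" if "\<epsilon> \<le> s"
    using upper[of s x] that pos(1) x by simp
  show lower: "R / \<epsilon> \<le> \<zeta> x s" if s: "a * \<epsilon> \<le> s" "s \<le> b * \<epsilon>"
  proof -
    have "bdd_below ((\<lambda>(y, t). \<epsilon> * \<zeta> y (\<epsilon> * t)) ` (\<Omega> \<times> {a..b}))"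
      using nonneg pos by (intro bdd_belowI2[of _ 0]) auto
    moreover have "(x, s / \<epsilon>) \<in> \<Omega> \<times> {a..b}"
      using x s pos(1) by (simp add: field_simps)
    ultimately have "(INF (y, t)\<in>\<Omega> \<times> {a..b}. \<epsilon> * \<zeta> y (\<epsilon> * t)) \<le> (\<lambda>(y, t). \<epsilon> * \<zeta> y (\<epsilon> * t)) (x, s / \<epsilon>)"
      by (rule cINF_lower)
    then have "R \<le> \<epsilon> * \<zeta> x s"
      using adm pos(1) by (simp add: admissible_reaction_def)
    then show ?thesis
      using pos(1) by (simp add: field_simps)
  qed
  show "R / \<epsilon> \<le> (SUP (y, t)\<in>\<Omega> \<times> {0..}. \<zeta> y t)" if s: "a * \<epsilon> \<le> s" "s \<le> b * \<epsilon>"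
  proof -
    have "\<zeta> y t \<le> B / \<epsilon> + C" if "y \<in> \<Omega>" "0 \<le> t" for y t
    proof -
      have "B / \<epsilon> * indicat_real {0<..<\<epsilon>} t \<le> B / \<epsilon>"
        using pos by (simp add: indicator_def)
      then show ?thesis
        using upper[OF that(2,1)] by linarith
    qed
    then have "bdd_above ((\<lambda>(y, t). \<zeta> y t) ` (\<Omega> \<times> {0..}))"
      by (intro bdd_aboveI2[of _ _ "B / \<epsilon> + C"]) auto
    moreover have "0 \<le> a * \<epsilon>"
      using pos by simp
    then have "(x, s) \<in> \<Omega> \<times> {0..}"
      using x s by simp
    ultimately have "(\<lambda>(y, t). \<zeta> y t) (x, s) \<le> (SUP (y, t)\<in>\<Omega> \<times> {0..}. \<zeta> y t)"
      by (rule cSUP_upper[rotated])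
    then show ?thesis
      using lower[OF s] by simp
  qed
qed

theorem corollary4p1:
  fixes \<Omega> \<Omega>' :: "(real ^ 'n) set"
    and A B C a b R :: real
  assumes "smooth_bounded_domain \<Omega>"
    and "0 < A" and "0 \<le> B" and "0 \<le> C"
    and "0 \<le> a" and "a < b" and "0 < R"
    and "open \<Omega>'" and "connected \<Omega>'"
    and "compact (closure \<Omega>')" and "closure \<Omega>' \<subseteq> \<Omega>"
  shows "\<exists>K>0. \<forall>\<epsilon>>0. \<forall>\<zeta> \<phi> u.
    admissible_reaction \<Omega> B C a b R \<epsilon> \<zeta> \<longrightarrow>
    continuous_on (closure \<Omega>) \<phi> \<longrightarrow>
    (\<forall>x\<in>closure \<Omega>. 0 \<le> \<phi> x \<and> \<phi> x \<le> A) \<longrightarrow>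
    perron_solution \<Omega> \<zeta> \<phi> u \<longrightarrow>
    (\<forall>x\<^sub>0\<in>\<Omega>'. u x\<^sub>0 > \<epsilon> \<longrightarrow>
       (let d = infdist x\<^sub>0 {x \<in> \<Omega>. 0 \<le> u x \<and> u x \<le> \<epsilon>}
        in \<epsilon> \<le> d \<longrightarrow> inverse K * d \<le> u x\<^sub>0 \<and> u x\<^sub>0 \<le> K * d))"
proof -
  have \<Omega>: "open \<Omega>" "bounded \<Omega>"
    using assms(1) by (simp_all add: smooth_bounded_domain_def)
  obtain \<delta> where \<delta>: "0 < \<delta>" "(\<Union>x\<in>closure \<Omega>'. cball x \<delta>) \<subseteq> \<Omega>"
    using compact_subset_open_imp_cball_epsilon_subset[OF assms(10) \<Omega>(1) assms(11)] .
  obtain D0 where D0: "\<And>x y. x \<in> \<Omega> \<Longrightarrow> y \<in> \<Omega> \<Longrightarrow> dist x y \<le> D0"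
    using \<Omega>(2) by (meson bounded_two_points)
  define D where "D = max D0 1"
  have D: "0 < D" "\<And>x y. x \<in> \<Omega> \<Longrightarrow> y \<in> \<Omega> \<Longrightarrow> dist x y \<le> D"
    using D0 by (auto simp: D_def le_max_iff_disj)
  obtain \<kappa> t where par: "0 < \<kappa>" "1 \<le> t" "8 * \<kappa>^3 * t\<^sup>2 < R" "a + \<kappa> * t\<^sup>2 \<le> b"
    using barrier_parameters_exist[OF assms(6,7)] .
  define \<rho> where "\<rho> = min (\<delta> / 4) (min (R / (C + 1)) ((\<kappa> / 4)^3 / (512 * (C + 1))))"
  have C1: "0 < C + 1"
    using assms(4) by simp
  have \<rho>: "0 < \<rho>" "4 * \<rho> \<le> \<delta>" "\<rho> * (C + 1) \<le> R" "512 * (C + 1) * \<rho> \<le> (\<kappa> / 4)^3"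
  proof -
    show "0 < \<rho>"
      using \<delta>(1) assms(7) C1 par(1) by (simp add: \<rho>_def)
    show "4 * \<rho> \<le> \<delta>"
      by (simp add: \<rho>_def min_le_iff_disj)
    have "\<rho> \<le> R / (C + 1)" "\<rho> \<le> (\<kappa> / 4)^3 / (512 * (C + 1))"
      by (simp_all add: \<rho>_def)
    then show "\<rho> * (C + 1) \<le> R" "512 * (C + 1) * \<rho> \<le> (\<kappa> / 4)^3"
      using C1 by (simp_all add: pos_le_divide_eq mult.commute)
  qed
  define k where "k = min (\<rho> / D) (\<kappa> / 16 * min (1 / 4) (\<rho> / D))"
  define M where "M = 64 + 128 * (B + C * \<delta>) + 2 * A / \<delta>"
  define K where "K = max M (inverse k)"
  have k: "0 < k"
    using \<rho>(1) D(1) par(1) by (simp add: k_def)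
  then have K: "0 < K" "M \<le> K" "inverse K \<le> k"
    by (auto simp: K_def less_max_iff_disj intro: le_imp_inverse_le[of "inverse k", simplified])
  have goal: "inverse K * d \<le> u x \<and> u x \<le> K * d"
    if e: "0 < \<epsilon>" and adm: "admissible_reaction \<Omega> B C a b R \<epsilon> \<zeta>"
      and \<phi>: "\<forall>x\<in>closure \<Omega>. 0 \<le> \<phi> x \<and> \<phi> x \<le> A" and u: "perron_solution \<Omega> \<zeta> \<phi> u"
      and x: "x \<in> \<Omega>'" "\<epsilon> < u x"
      and d: "d = infdist x {x \<in> \<Omega>. 0 \<le> u x \<and> u x \<le> \<epsilon>}" "\<epsilon> \<le> d" for \<epsilon> \<zeta> \<phi> u x d
  proof -
    define Z where "Z = {x \<in> \<Omega>. 0 \<le> u x \<and> u x \<le> \<epsilon>}"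
    obtain u_lo u_hi where
      lo: "viscosity_solution \<Omega> (\<lambda>_ _. SUP (y, t)\<in>\<Omega> \<times> {0..}. \<zeta> y t) u_lo" and
      hi: "viscosity_solution \<Omega> (\<lambda>_ _. 0) u_hi" "has_boundary_values \<Omega> \<phi> u_hi" and
      inf: "\<forall>x\<in>closure \<Omega>. u x = (INF w\<in>perron_class \<Omega> \<zeta> \<phi> u_lo u_hi. w x)"
      using u unfolding perron_solution_def by blast
    let ?P = "perron_class \<Omega> \<zeta> \<phi> u_lo u_hi"
    have x\<Omega>: "x \<in> \<Omega>" "cball x \<delta> \<subseteq> \<Omega>"
      using x(1) \<delta>(2) assms(11) closure_subset[of \<Omega>'] by blast+
    \<comment> \<open>\<open>infdist\<close> to the empty set is \<open>0\<close>, which \<open>0 < \<epsilon> \<le> d\<close> excludes.\<close>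
    have Z: "Z \<noteq> {}"
      using d e by (auto simp: Z_def[symmetric] infdist_def)
    then obtain z where z: "z \<in> \<Omega>" "u z \<le> \<epsilon>" "z \<in> Z"
      by (auto simp: Z_def)
    have dD: "d \<le> D"
      using infdist_le[OF z(3), of x] D(2)[OF x\<Omega>(1) z(1)] d(1) by (simp add: Z_def)
    \<comment> \<open>Over an empty class the infimum is the same default value at \<open>x\<close> and at \<open>z\<close>.\<close>
    have P: "?P \<noteq> {}"
    proof
      assume "?P = {}"
      then have "u x = u z"
        using inf subsetD[OF closure_subset x\<Omega>(1)] subsetD[OF closure_subset z(1)] by simp
      then show False
        using x(2) z(2) by simp
    qed
    have above: "\<epsilon> < u y" if "y \<in> \<Omega>" "dist x y < d" for y
    proof (rule ccontr)
      assume "\<not> \<epsilon> < u y"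
      then have "y \<in> Z"
        using perron_envelope_nonneg[OF inf P that(1)] that(1) by (simp add: Z_def)
      then have "d \<le> dist x y"
        using infdist_le[of y Z x] d(1) by (simp add: Z_def)
      then show False
        using that(2) by simp
    qed
    have u_hi_le: "u_hi y \<le> A" if "y \<in> \<Omega>" for y
    proof (rule subsolution_le_boundary_bound[OF \<Omega> _ _ _ that])
      show "viscosity_subsolution \<Omega> (\<lambda>_ _. 0) u_hi" "continuous_on (closure \<Omega>) u_hi"
        using hi by (simp_all add: viscosity_solution_def has_boundary_values_def)
      show "u_hi v \<le> A" if "v \<in> frontier \<Omega>" for v
        using hi(2) \<phi> that by (simp add: has_boundary_values_def frontier_def)
    qed
    note \<zeta> = admissible_reactionD[OF adm e assms(5,3,4)]
    have "u x \<le> M * d"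
      unfolding M_def
      using assms(2-4)
      by (intro perron_upper_bound[OF P inf u_hi_le \<zeta>(2) _ _ _ \<delta>(1) x\<Omega>(2) e d(2) Z_def Z _ above])
        (auto simp: d(1) Z_def)
    also have "\<dots> \<le> K * d"
      using K(2) d(2) e by (intro mult_right_mono) auto
    finally have "u x \<le> K * d" .
    moreover have "k * d \<le> u x"
      unfolding k_def
    proof (rule perron_lower_bound[OF \<Omega>(1) x\<Omega>(1) e par(1-3) assms(5) par(4) assms(4) P inf
          _ _ \<zeta>(1,4,3) \<rho>(1) _ \<rho>(3,4) d(2) dD above])
      show "viscosity_subsolution \<Omega> (\<lambda>_ _. SUP (y, t)\<in>\<Omega> \<times> {0..}. \<zeta> y t) u_lo"
        using lo by (simp add: viscosity_solution_def)
      show "R / \<epsilon> \<le> (SUP (y, t)\<in>\<Omega> \<times> {0..}. \<zeta> y t)"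
        using assms(6) e by (intro \<zeta>(5)[OF x\<Omega>(1), of "a * \<epsilon>"]) auto
      show "cball x (4 * \<rho>) \<subseteq> \<Omega>"
        using subset_cball[OF \<rho>(2)] x\<Omega>(2) by blast
    qed
    moreover have "inverse K * d \<le> k * d"
      using K(3) d(2) e by (intro mult_right_mono) auto
    ultimately show ?thesis
      by linarith
  qed
  show ?thesis
    unfolding Let_def by (intro exI[of _ K] conjI[OF K(1)] allI impI ballI) (rule goal, assumption+, rule refl)
qed

end
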